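(* Let $A,B$ be binary forms of order $d$ whose coefficients are algebraically independent indeterminates over $\mathbf{C}$, and let $\mathbf{J}$ be a nonzero (homogeneous) invariant of $A$ of degree $n\ge1$, with first evectant $\mathcal{E}_{\mathbf J}$. Put $T_{2r+1}=(A,B)_{2r+1}$ and $$\beta(A,\mathcal{R})=-\frac{1}{\mathbf{J}}\sum_{r=0}^{\lfloor (d-1)/2\rfloor}c_r\,(\mathcal{E}_{\mathbf J},T_{2r+1})_{d-2r-1},\qquad c_r=\frac{2\binom{d}{2r+1}^2}{\binom{2d-2r}{2r+1}}.$$ Then $$\beta(A,\mathcal{R})=B-\frac{(\mathcal{E}_{\mathbf J},B)_d}{\mathbf{J}}\,A.$$
   Context: A form of order $e$ is a homogeneous polynomial of degree $e$ in $(x_0,x_1)$, here with coefficients in the field generated over $\mathbf{C}$ by the coefficients of $A$ and $B$. Write $$A=\sum_{p=0}^d\binom{d}{p}a_p\,x_0^{d-p}x_1^p .$$ An invariant of $A$ of degree $n$ is a homogeneous polynomial $\mathbf{J}$ of degree $n$ in $a_0,\dots,a_d$ with coefficients in $\mathbf{C}$ that is unchanged under the action of $SL_2(\mathbf{C})$ on forms of order $d$. Its first evectant is $$\mathcal{E}_{\mathbf J}=\frac{(-1)^d}{n}\sum_{q=0}^d(-1)^q\frac{\partial\mathbf{J}}{\partial a_q}\,x_0^qx_1^{d-q}.$$ For forms $E,F$ of orders $e,f$ and $0\le r\le\min\{e,f\}$, the $r$-th transvectant is $$(E,F)_r=\frac{(e-r)!(f-r)!}{e!f!}\sum_{i=0}^r(-1)^i\binom{r}{i}\frac{\partial^rE}{\partial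 x_0^{r-i}\partial x_1^i}\,\frac{\partial^rF}{\partial x_0^i\partial x_1^{r-i}},$$ and $(E,F)_r=0$ for $r>\min\{e,f\}$. The symbol $\mathcal{R}=\mathcal{R}(A,B)=\big(A(\mathbf{x})B(\mathbf{y})-B(\mathbf{x})A(\mathbf{y})\big)/(x_0y_1-x_1y_0)$ is the Bézoutiant, which determines the $T_{2r+1}$; this is why the left side is written as a function of $A$ and $\mathcal{R}$. *)

theory Defs
  imports "HOL-Analysis.Determinants" "HOL-Library.Poly_Mapping"
begin

section \<open>Multivariate polynomials\<close>

type_synonym ('v, 'a) mpoly = "('v \<Rightarrow>\<^sub>0 nat) \<Rightarrow>\<^sub>0 'a"

definition Const :: "'a::zero \<Rightarrow> ('v, 'a) mpoly" where
  "Const c = Poly_Mapping.single 0 c"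

definition Var :: "'v \<Rightarrow> ('v, 'a::zero_neq_one) mpoly" where
  "Var i = Poly_Mapping.single (Poly_Mapping.single i 1) 1"

definition vars :: "('v, 'a::zero) mpoly \<Rightarrow> 'v set" where
  "vars p = (\<Union>m\<in>Poly_Mapping.keys p. Poly_Mapping.keys m)"

definition homogeneous :: "nat \<Rightarrow> ('v, 'a::zero) mpoly \<Rightarrow> bool" where
  "homogeneous n p \<longleftrightarrow>
     (\<forall>m\<in>Poly_Mapping.keys p. (\<Sum>i\<in>Poly_Mapping.keys m. Poly_Mapping.lookup m i) = n)"

text \<open>Evaluation at the point \<open>v\<close>, the coefficients being transported along \<open>h\<close>.\<close>

definition eval_mpoly ::
  "('a::zero \<Rightarrow> 'b::comm_semiring_1) \<Rightarrow> ('v \<Rightarrow> 'b) \<Rightarrow> ('v, 'a) mpoly \<Rightarrow> 'b" where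
  "eval_mpoly h v p =
     (\<Sum>m\<in>Poly_Mapping.keys p.
        h (Poly_Mapping.lookup p m) * (\<Prod>i\<in>Poly_Mapping.keys m. v i ^ Poly_Mapping.lookup m i))"

text \<open>Formal partial derivative. Where \<open>i\<close> does not occur in \<open>m\<close>, the truncated subtraction
  is harmless because the coefficient vanishes.\<close>

definition pdiff :: "'v \<Rightarrow> ('v, 'a::comm_semiring_1) mpoly \<Rightarrow> ('v, 'a) mpoly" where
  "pdiff i p =
     (\<Sum>m\<in>Poly_Mapping.keys p.
        Poly_Mapping.single (m - Poly_Mapping.single i 1)
          (of_nat (Poly_Mapping.lookup m i) * Poly_Mapping.lookup p m))"

section \<open>Field extensions of the complex numbers\<close>

definition field_embedding :: "(complex \<Rightarrow> 'k::field) \<Rightarrow> bool" where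
  "field_embedding \<iota> \<longleftrightarrow>
     \<iota> 1 = 1 \<and> (\<forall>x y. \<iota> (x + y) = \<iota> x + \<iota> y) \<and> (\<forall>x y. \<iota> (x * y) = \<iota> x * \<iota> y)"

definition algebraically_independent ::
  "(complex \<Rightarrow> 'k::field) \<Rightarrow> 'v set \<Rightarrow> ('v \<Rightarrow> 'k) \<Rightarrow> bool" where
  "algebraically_independent \<iota> I v \<longleftrightarrow>
     (\<forall>p :: ('v, complex) mpoly. vars p \<subseteq> I \<and> eval_mpoly \<iota> v p = 0 \<longrightarrow> p = 0)"

section \<open>Binary forms\<close>

text \<open>Binary forms are polynomials in the variables \<open>Var 0\<close> and \<open>Var 1\<close>, which stand for
  \<open>x\<^sub>0\<close> and \<open>x\<^sub>1\<close>; the form with all coefficients zero counts as a form of every order.\<close>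

definition form :: "nat \<Rightarrow> (nat \<Rightarrow> 'a::comm_semiring_1) \<Rightarrow> (nat, 'a) mpoly" where
  "form d a = (\<Sum>p\<le>d. Const (of_nat (d choose p) * a p) * Var 0 ^ (d - p) * Var 1 ^ p)"

text \<open>The inverse of \<open>form d\<close>: the coefficients \<open>a\<^sub>p\<close>, stripped of the binomial factors.\<close>

definition form_coeff :: "nat \<Rightarrow> (nat, 'a::field) mpoly \<Rightarrow> nat \<Rightarrow> 'a" where
  "form_coeff d F p =
     Poly_Mapping.lookup F (Poly_Mapping.single 0 (d - p) + Poly_Mapping.single 1 p)
       / of_nat (d choose p)"

text \<open>\<open>lin_subst g F\<close> is the form \<open>F(g x)\<close>. This is a right action; the left action
  \<open>F(g\<^sup>-\<^sup>1 x)\<close> of the special linear group has the same invariants.\<close>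

definition lin_subst :: "'a::comm_semiring_1^2^2 \<Rightarrow> (nat, 'a) mpoly \<Rightarrow> (nat, 'a) mpoly" where
  "lin_subst g F =
     eval_mpoly Const
       (\<lambda>i. if i = 0 then Const (g $ 1 $ 1) * Var 0 + Const (g $ 1 $ 2) * Var 1
                     else Const (g $ 2 $ 1) * Var 0 + Const (g $ 2 $ 2) * Var 1) F"

text \<open>In \<open>J\<close> the variable \<open>Var p\<close> stands for the coefficient \<open>a\<^sub>p\<close> of the generic form
  of order \<open>d\<close>.\<close>

definition invariant :: "nat \<Rightarrow> nat \<Rightarrow> (nat, complex) mpoly \<Rightarrow> bool" where
  "invariant d n J \<longleftrightarrow>
     vars J \<subseteq> {..d} \<and> homogeneous n J \<and>
     (\<forall>(g :: complex^2^2) c. det g = 1 \<longrightarrow>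
        eval_mpoly id (form_coeff d (lin_subst g (form d c))) J = eval_mpoly id c J)"

definition evectant ::
  "(complex \<Rightarrow> 'k::field) \<Rightarrow> nat \<Rightarrow> nat \<Rightarrow> (nat, complex) mpoly \<Rightarrow> (nat \<Rightarrow> 'k) \<Rightarrow> (nat, 'k) mpoly"
  where
  "evectant \<iota> d n J a =
     Const ((- 1) ^ d / of_nat n) *
       (\<Sum>q\<le>d. Const ((- 1) ^ q * eval_mpoly \<iota> a (pdiff q J)) * Var 0 ^ q * Var 1 ^ (d - q))"

text \<open>\<open>transvectant e f r E F\<close> is \<open>(E, F)\<^sub>r\<close> for forms \<open>E\<close>, \<open>F\<close> of orders \<open>e\<close>, \<open>f\<close>. The orders
  are passed explicitly because the zero form does not determine its order.\<close>

definition transvectant ::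
  "nat \<Rightarrow> nat \<Rightarrow> nat \<Rightarrow> (nat, 'k::field_char_0) mpoly \<Rightarrow> (nat, 'k) mpoly \<Rightarrow> (nat, 'k) mpoly" where
  "transvectant e f r E F =
     (if r \<le> min e f
      then Const ((fact (e - r) * fact (f - r)) / (fact e * fact f)) *
           (\<Sum>i\<le>r. Const ((- 1) ^ i * of_nat (r choose i)) *
              ((pdiff 0 ^^ (r - i)) ((pdiff 1 ^^ i) E)) *
              ((pdiff 0 ^^ i) ((pdiff 1 ^^ (r - i)) F)))
      else 0)"

text \<open>\<open>T r\<close> stands for \<open>T\<^sub>2\<^sub>r\<^sub>+\<^sub>1\<close>, a form of order \<open>2 d - 2 (2 r + 1)\<close>. These transvectants are
  determined by the Bezoutiant, so they play its part as the second argument of \<open>\<beta>\<close>. The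
  index set is \<open>{0, \<dots>, \<lfloor>(d - 1) / 2\<rfloor>}\<close>, computed with integers so that it is empty for \<open>d = 0\<close>.\<close>

definition beta ::
  "(complex \<Rightarrow> 'k::field_char_0) \<Rightarrow> nat \<Rightarrow> nat \<Rightarrow> (nat, complex) mpoly \<Rightarrow> (nat \<Rightarrow> 'k) \<Rightarrow>
     (nat \<Rightarrow> (nat, 'k) mpoly) \<Rightarrow> (nat, 'k) mpoly" where
  "beta \<iota> d n J a T =
     - Const (1 / eval_mpoly \<iota> a J) *
       (\<Sum>r | int r \<le> (int d - 1) div 2.
          Const (2 * of_nat (d choose (2 * r + 1)) ^ 2
                   / of_nat ((2 * d - 2 * r) choose (2 * r + 1))) *
          transvectant d (2 * d - 2 * (2 * r + 1)) (d - 2 * r - 1) (evectant \<iota> d n J a) (T r))"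

end

theory Submission
  imports Defs "HOL-Computational_Algebra.Polynomial"
begin

text \<open>The theorem is an instance of an identity between arbitrary forms \<open>E\<close>, \<open>A\<close>, \<open>B\<close> of order \<open>d\<close>: the sum
of the \<open>c\<^sub>r (E, T\<^sub>2\<^sub>r\<^sub>+\<^sub>1)\<close>, where the transvectant has index \<open>d - 2 r - 1\<close>, equals
\<open>(E, B)\<^sub>d A - (E, A)\<^sub>d B\<close> (\<open>trilinear_defect_zero\<close>). For \<open>E\<close> the evectant of \<open>J\<close>, the full transvectant
\<open>(E, A)\<^sub>d\<close> is \<open>1/n\<close> times the sum of the \<open>a\<^sub>q \<partial>J/\<partial>a\<^sub>q\<close>, hence equals \<open>J(a)\<close> by Euler's identity
(\<open>transvectant_evectant_form\<close>). Algebraic independence makes \<open>J(a)\<close> nonzero, and dividing by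
\<open>- J(a)\<close> gives the claim.\<close>

text \<open>Both sides of the identity are linear in each of \<open>E\<close>, \<open>A\<close>, \<open>B\<close>. A linear map that kills
\<open>(x\<^sub>0 + t x\<^sub>1)\<^sup>d\<close> for all \<open>t\<close> kills every form of order \<open>d\<close>, because its values there are polynomials
in \<open>t\<close> with infinitely many zeros. So it is enough to treat \<open>d\<close>-th powers of the linear forms
with parameters \<open>e\<close>, \<open>l\<close>, \<open>m\<close>. On such powers transvection is repeated application of a derivation
in the direction of the zero of the linear form (\<open>transvectant_power_left\<close>), and everything
becomes explicit in terms of \<open>u = (m - e)(x\<^sub>0 + l x\<^sub>1)\<close> and \<open>v = (l - e)(x\<^sub>0 + m x\<^sub>1)\<close>, which satisfy
the Pluecker relation \<open>u - v = (m - l)(x\<^sub>0 + e x\<^sub>1)\<close>. The right side is \<open>u\<^sup>d - v\<^sup>d\<close>, and the summand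
with \<open>k = 2 r + 1\<close> is a constant times \<open>(u - v)\<^sup>k Q\<^sub>d\<^sub>-\<^sub>k(u, v)\<close>, where \<open>Q\<^sub>s(u, v)\<close> is the sum over \<open>j\<close>
of the squares of the binomial coefficients \<open>s\<close> over \<open>j\<close> times \<open>v\<^sup>j u\<^sup>s\<^sup>-\<^sup>j\<close>.\<close>

text \<open>Now \<open>Q\<^sub>s\<close> is the homogenised Legendre polynomial \<open>(u - v)\<^sup>s P\<^sub>s((u + v)/(u - v))\<close>. What remains is the
classical expansion of \<open>((1 + x)/2)\<^sup>d\<close> in Legendre polynomials (\<open>power_legendre_expansion\<close>), proved
by induction on \<open>d\<close> from the three-term recurrence. Since \<open>Q\<^sub>s\<close> is symmetric, exchanging \<open>u\<close> and \<open>v\<close>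
and subtracting leaves exactly the odd powers of \<open>u - v\<close>, with coefficients doubled. This
accounts for the odd indices \<open>2 r + 1\<close> and for the factor \<open>2\<close> in \<open>c\<^sub>r\<close>.\<close>

section \<open>Constants, linear maps and derivations\<close>

lemma Const_0 [simp]: "Const 0 = 0"
  by (simp add: Const_def)

lemma Const_1 [simp]: "Const 1 = 1"
  by (simp add: Const_def)

lemma Const_add: "Const (x + y) = Const x + Const y"
  by (simp add: Const_def single_add)

lemma Const_diff: "Const (x - y :: 'a::ab_group_add) = Const x - Const y"
  by (simp add: Const_def single_diff)

lemma Const_sum: "Const (sum f I :: 'a::comm_monoid_add) = (\<Sum>i\<in>I. Const (f i))"
  by (induction I rule: infinite_finite_induct) (simp_all add: Const_add)

lemma Const_uminus: "Const (- x :: 'a::ab_group_add) = - Const x"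
  by (simp add: Const_def single_uminus)

lemma Const_mult: "Const (x * y :: 'a::comm_semiring_1) = Const x * Const y"
  by (simp add: Const_def mult_single)

lemma Const_power: "Const (x ^ n :: 'a::comm_semiring_1) = Const x ^ n"
  by (induction n) (simp_all add: Const_mult)

lemma Const_of_nat: "Const (of_nat n :: 'a::comm_semiring_1) = of_nat n"
  by (simp add: Const_def)

lemma Const_numeral: "Const (numeral n :: 'a::comm_semiring_1) = numeral n"
  by (simp add: Const_def)

lemma Const_mult_assoc: "Const x * (Const y * F) = Const (x * y :: 'a::comm_semiring_1) * F"
  by (simp add: Const_mult mult.assoc)

lemma lookup_Const_mult:
  "Poly_Mapping.lookup (Const c * F) m = c * Poly_Mapping.lookup F m"
  for F :: "('v, 'a::comm_semiring_1) mpoly"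
  unfolding Const_def mult_map_scale_conv_mult[symmetric]
  by (simp add: map.rep_eq when_def)

lemma mpoly_sum_monomials:
  "(\<Sum>m\<in>Poly_Mapping.keys p. Poly_Mapping.single m (Poly_Mapping.lookup p m)) = p"
  by (rule poly_mapping_eqI)
     (simp add: lookup_sum lookup_single when_def sum.delta in_keys_iff)

text \<open>Linearity over the coefficients, with scalars in the shape of constant polynomials.\<close>

definition Const_linear ::
  "(('v, 'a::comm_semiring_1) mpoly \<Rightarrow> ('w, 'a) mpoly) \<Rightarrow> bool" where
  "Const_linear \<Phi> \<longleftrightarrow>
     (\<forall>F G. \<Phi> (F + G) = \<Phi> F + \<Phi> G) \<and> (\<forall>c F. \<Phi> (Const c * F) = Const c * \<Phi> F)"

lemma Const_linearI:
  "(\<And>F G. \<Phi> (F + G) = \<Phi> F + \<Phi> G) \<Longrightarrow> (\<And>c F. \<Phi> (Const c * F) = Const c * \<Phi> F) \<Longrightarrow> Const_linear \<Phi>"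
  by (simp add: Const_linear_def)

lemma Const_linear_add: "Const_linear \<Phi> \<Longrightarrow> \<Phi> (F + G) = \<Phi> F + \<Phi> G"
  by (simp add: Const_linear_def)

lemma Const_linear_scale: "Const_linear \<Phi> \<Longrightarrow> \<Phi> (Const c * F) = Const c * \<Phi> F"
  by (simp add: Const_linear_def)

lemma Const_linear_0: "Const_linear \<Phi> \<Longrightarrow> \<Phi> 0 = 0"
  using Const_linear_scale[of \<Phi> 0 0] by simp

lemma Const_linear_of_nat: "Const_linear \<Phi> \<Longrightarrow> \<Phi> (of_nat k * F) = of_nat k * \<Phi> F"
  using Const_linear_scale[of \<Phi> "of_nat k"] by (simp add: Const_of_nat)

lemma Const_linear_sum: "Const_linear \<Phi> \<Longrightarrow> \<Phi> (sum f I) = (\<Sum>i\<in>I. \<Phi> (f i))"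
  by (induction I rule: infinite_finite_induct) (simp_all add: Const_linear_0 Const_linear_add)

lemma Const_linear_id: "Const_linear (\<lambda>F. F)"
  by (simp add: Const_linear_def)

lemma Const_linear_mult_left: "Const_linear \<Phi> \<Longrightarrow> Const_linear (\<lambda>F. P * \<Phi> F)"
  by (simp add: Const_linear_def algebra_simps)

lemma Const_linear_mult_right: "Const_linear \<Phi> \<Longrightarrow> Const_linear (\<lambda>F. \<Phi> F * P)"
  by (simp add: Const_linear_def algebra_simps)

lemma Const_linear_compose:
  "Const_linear \<Psi> \<Longrightarrow> Const_linear \<Phi> \<Longrightarrow> Const_linear (\<lambda>F. \<Psi> (\<Phi> F))"
  by (simp add: Const_linear_def)

lemma Const_linear_diff:
  fixes \<Phi> \<Psi> :: "('v, 'a::comm_ring_1) mpoly \<Rightarrow> ('w, 'a) mpoly"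
  shows "Const_linear \<Phi> \<Longrightarrow> Const_linear \<Psi> \<Longrightarrow> Const_linear (\<lambda>F. \<Phi> F - \<Psi> F)"
  by (simp add: Const_linear_def algebra_simps)

lemma Const_linear_sum_fun:
  "(\<And>i. i \<in> I \<Longrightarrow> Const_linear (\<Phi> i)) \<Longrightarrow> Const_linear (\<lambda>F. \<Sum>i\<in>I. \<Phi> i F)"
  by (simp add: Const_linear_def sum.distrib sum_distrib_left)

lemma Const_linear_funpow:
  fixes \<Phi> :: "('v, 'a::comm_semiring_1) mpoly \<Rightarrow> ('v, 'a) mpoly"
  shows "Const_linear \<Phi> \<Longrightarrow> Const_linear (\<Phi> ^^ n)"
proof (induction n)
  case 0
  then show ?case by (simp add: Const_linear_def)
next
  case (Suc n)
  then show ?case by (simp add: Const_linear_def)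
qed

lemma lookup_pdiff:
  "Poly_Mapping.lookup (pdiff i p) m =
     of_nat (Poly_Mapping.lookup m i + 1) * Poly_Mapping.lookup p (m + Poly_Mapping.single i 1)"
proof -
  let ?e = "Poly_Mapping.single i (1::nat)"
  have key: "m' = m + ?e" if "m' - ?e = m" "Poly_Mapping.lookup m' i \<noteq> 0" for m'
  proof (rule poly_mapping_eqI)
    fix k
    have "Poly_Mapping.lookup m k = Poly_Mapping.lookup m' k - Poly_Mapping.lookup ?e k"
      using that(1) by (metis lookup_minus)
    then show "Poly_Mapping.lookup m' k = Poly_Mapping.lookup (m + ?e) k"
      using that(2) by (auto simp: lookup_add lookup_single when_def)
  qed
  have "Poly_Mapping.lookup (pdiff i p) m =
      (\<Sum>m'\<in>Poly_Mapping.keys p.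
         if m' = m + ?e then of_nat (Poly_Mapping.lookup m' i) * Poly_Mapping.lookup p m' else 0)"
    unfolding pdiff_def lookup_sum
  proof (rule sum.cong)
    fix m'
    show "Poly_Mapping.lookup (Poly_Mapping.single (m' - ?e)
            (of_nat (Poly_Mapping.lookup m' i) * Poly_Mapping.lookup p m')) m =
          (if m' = m + ?e then of_nat (Poly_Mapping.lookup m' i) * Poly_Mapping.lookup p m' else 0)"
    proof (cases "Poly_Mapping.lookup m' i = 0")
      case False
      then have "m' - ?e = m \<longleftrightarrow> m' = m + ?e"
        using key by auto
      then show ?thesis by (simp add: lookup_single when_def)
    qed (auto simp: lookup_add)
  qed simp
  also have "\<dots> = of_nat (Poly_Mapping.lookup m i + 1) * Poly_Mapping.lookup p (m + ?e)"
    by (simp add: in_keys_iff lookup_add del: One_nat_def)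
  finally show ?thesis .
qed

lemma Const_linear_pdiff: "Const_linear (pdiff i)"
  by (rule Const_linearI; rule poly_mapping_eqI)
     (simp_all add: lookup_pdiff lookup_add lookup_Const_mult distrib_left mult.left_commute)

lemma pdiff_commute: "pdiff i (pdiff j p) = pdiff j (pdiff i p)"
  by (cases "i = j", simp, rule poly_mapping_eqI)
     (simp add: lookup_pdiff lookup_add lookup_single_not_eq algebra_simps)

lemma pdiff_single:
  "pdiff i (Poly_Mapping.single m c) =
     Poly_Mapping.single (m - Poly_Mapping.single i 1) (of_nat (Poly_Mapping.lookup m i) * c)"
  by (cases "c = 0") (simp_all add: pdiff_def)

text \<open>Derivations over the coefficient ring; they annihilate the constants because they are linear and
annihilate \<open>1\<close>.\<close>

definition derivation :: "(('v, 'a::comm_ring_1) mpoly \<Rightarrow> ('v, 'a) mpoly) \<Rightarrow> bool" where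
  "derivation D \<longleftrightarrow> Const_linear D \<and> (\<forall>F G. D (F * G) = D F * G + F * D G)"

lemma derivation_linear: "derivation D \<Longrightarrow> Const_linear D"
  by (simp add: derivation_def)

lemma derivation_mult: "derivation D \<Longrightarrow> D (F * G) = D F * G + F * D G"
  by (simp add: derivation_def)

lemma derivation_1: "derivation D \<Longrightarrow> D 1 = 0"
  using derivation_mult[of D 1 1] by simp

lemma pdiff_single_mult:
  "pdiff i (Poly_Mapping.single m c * Poly_Mapping.single m' c') =
     pdiff i (Poly_Mapping.single m c) * Poly_Mapping.single m' c' +
     Poly_Mapping.single m c * pdiff i (Poly_Mapping.single m' c')"
proof -
  let ?e = "Poly_Mapping.single i (1::nat)"
  have *: "m1 - ?e + m2 = m1 + m2 - ?e" if "Poly_Mapping.lookup m1 i \<noteq> 0" for m1 m2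
    using that by (intro poly_mapping_eqI) (auto simp: lookup_add lookup_minus lookup_single when_def)
  have 1: "pdiff i (Poly_Mapping.single m c) * Poly_Mapping.single m' c' =
      Poly_Mapping.single (m + m' - ?e) (of_nat (Poly_Mapping.lookup m i) * (c * c'))"
    using *[of m m'] by (cases "Poly_Mapping.lookup m i = 0")
      (simp_all add: pdiff_single mult_single mult.assoc)
  have 2: "Poly_Mapping.single m c * pdiff i (Poly_Mapping.single m' c') =
      Poly_Mapping.single (m + m' - ?e) (of_nat (Poly_Mapping.lookup m' i) * (c * c'))"
    using *[of m' m] by (cases "Poly_Mapping.lookup m' i = 0")
      (simp_all add: pdiff_single mult_single ac_simps)
  show ?thesis
    unfolding 1 2 unfolding mult_single pdiff_single
    by (simp only: single_add[symmetric] lookup_add of_nat_add distrib_right)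
qed

lemma derivation_pdiff: "derivation (pdiff i)"
  unfolding derivation_def
proof (intro conjI allI Const_linear_pdiff)
  fix F G :: "('a, 'b) mpoly"
  let ?s = "\<lambda>F m. Poly_Mapping.single m (Poly_Mapping.lookup F m)"
  note lin = Const_linear_sum[OF Const_linear_pdiff]
  have "pdiff i ((\<Sum>m\<in>Poly_Mapping.keys F. ?s F m) * (\<Sum>m\<in>Poly_Mapping.keys G. ?s G m)) =
      pdiff i (\<Sum>m\<in>Poly_Mapping.keys F. ?s F m) * (\<Sum>m\<in>Poly_Mapping.keys G. ?s G m) +
      (\<Sum>m\<in>Poly_Mapping.keys F. ?s F m) * pdiff i (\<Sum>m\<in>Poly_Mapping.keys G. ?s G m)"
    unfolding sum_product lin pdiff_single_mult sum.distrib ..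
  then show "pdiff i (F * G) = pdiff i F * G + F * pdiff i G"
    by (simp only: mpoly_sum_monomials)
qed

lemma derivation_power:
  assumes "derivation D" and "D L = Const c"
  shows "D (L ^ n) = of_nat n * Const c * L ^ (n - 1)"
proof (induction n)
  case 0
  then show ?case using assms by (simp add: derivation_1)
next
  case (Suc n)
  then show ?case
    using assms by (cases n) (simp_all add: derivation_mult algebra_simps derivation_1)
qed

lemma derivation_funpow_power:
  fixes L :: "('v, 'a::field_char_0) mpoly"
  assumes "derivation D" and "D L = Const c" and "j \<le> n"
  shows "(D ^^ j) (L ^ n) = Const (fact n / fact (n - j) * c ^ j) * L ^ (n - j)"
  using \<open>j \<le> n\<close>
proof (induction j)
  case 0
  then show ?case by simp
next
  case (Suc j)
  let ?r = "fact n / fact (n - j) :: 'a"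
  have "n - j = Suc (n - Suc j)" using Suc.prems by simp
  then have fac: "?r * of_nat (n - j) = fact n / fact (n - Suc j)"
    by (simp del: of_nat_Suc)
  have "(D ^^ Suc j) (L ^ n) = Const (?r * c ^ j) * D (L ^ (n - j))"
    using Suc assms(1) by (simp add: Const_linear_scale[OF derivation_linear])
  also have "\<dots> = Const (?r * c ^ j) * (Const (of_nat (n - j) * c) * L ^ (n - Suc j))"
    by (simp add: derivation_power[OF assms(1,2)] Const_mult Const_of_nat)
  also have "\<dots> = Const ((?r * of_nat (n - j)) * c ^ Suc j) * L ^ (n - Suc j)"
    by (simp only: Const_mult power_Suc ac_simps)
  finally show ?case unfolding fac .
qed

text \<open>Pascal's rule, summed. It is the induction step of both binomial theorems below: the Leibniz rule
for \<open>D ^^ n\<close>, and the expansion of a power of a directional derivative.\<close>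

lemma binomial_sum_Suc:
  fixes f :: "nat \<Rightarrow> nat \<Rightarrow> 'a::comm_semiring_1"
  shows "(\<Sum>i\<le>Suc n. of_nat (Suc n choose i) * f i (Suc n - i)) =
         (\<Sum>i\<le>n. of_nat (n choose i) * (f (Suc i) (n - i) + f i (Suc n - i)))"
proof -
  have "(\<Sum>i\<le>n. of_nat (n choose Suc i) * f (Suc i) (n - i)) =
        (\<Sum>i<n. of_nat (n choose Suc i) * f (Suc i) (Suc n - Suc i))"
    by (simp add: lessThan_Suc_atMost[symmetric] binomial_eq_0)
  then have "f 0 (Suc n) + (\<Sum>i\<le>n. of_nat (n choose Suc i) * f (Suc i) (n - i)) =
      (\<Sum>i<Suc n. of_nat (n choose i) * f i (Suc n - i))"
    unfolding sum.lessThan_Suc_shift by simp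
  then have *: "f 0 (Suc n) + (\<Sum>i\<le>n. of_nat (n choose Suc i) * f (Suc i) (n - i)) =
      (\<Sum>i\<le>n. of_nat (n choose i) * f i (Suc n - i))"
    by (simp only: lessThan_Suc_atMost)
  show ?thesis
    unfolding sum.atMost_Suc_shift
    by (simp add: distrib_left distrib_right sum.distrib *[symmetric] ac_simps)
qed

lemma derivation_funpow_mult:
  assumes D: "derivation D"
  shows "(D ^^ n) (F * G) = (\<Sum>j\<le>n. of_nat (n choose j) * ((D ^^ j) F * (D ^^ (n - j)) G))"
proof (induction n)
  case 0
  then show ?case by simp
next
  case (Suc n)
  have "(D ^^ Suc n) (F * G) =
      (\<Sum>j\<le>n. of_nat (n choose j) * D ((D ^^ j) F * (D ^^ (n - j)) G))"
    using Suc by (simp add: Const_linear_sum[OF derivation_linear[OF D]]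
        Const_linear_of_nat[OF derivation_linear[OF D]])
  also have "\<dots> = (\<Sum>j\<le>n. of_nat (n choose j) *
      ((D ^^ Suc j) F * (D ^^ (n - j)) G + (D ^^ j) F * (D ^^ (Suc n - j)) G))"
    by (intro sum.cong) (simp_all add: derivation_mult[OF D] Suc_diff_le)
  also have "\<dots> = (\<Sum>j\<le>Suc n. of_nat (Suc n choose j) * ((D ^^ j) F * (D ^^ (Suc n - j)) G))"
    by (rule binomial_sum_Suc[symmetric])
  finally show ?case .
qed

section \<open>Transvectants with powers of linear forms\<close>

text \<open>The derivative in the direction \<open>(- t, 1)\<close>, which is the zero of the linear form \<open>x\<^sub>0 + t x\<^sub>1\<close>.\<close>

definition dder :: "'a::comm_ring_1 \<Rightarrow> (nat, 'a) mpoly \<Rightarrow> (nat, 'a) mpoly" where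
  "dder t F = pdiff 1 F - Const t * pdiff 0 F"

lemma derivation_dder: "derivation (dder t)"
  unfolding derivation_def
proof (intro conjI allI)
  show "Const_linear (dder t)"
    unfolding dder_def
    by (intro Const_linear_diff Const_linear_mult_left Const_linear_pdiff)
  show "dder t (F * G) = dder t F * G + F * dder t G" for F G
    by (simp add: dder_def derivation_mult[OF derivation_pdiff] algebra_simps)
qed

lemma pdiff_funpow_commute: "(pdiff i ^^ m) (pdiff j F) = pdiff j ((pdiff i ^^ m) F)"
  by (induction m) (simp_all add: pdiff_commute)

lemma dder_funpow:
  "(dder t ^^ r) F =
     (\<Sum>i\<le>r. of_nat (r choose i) * (Const ((- t) ^ i) * (pdiff 0 ^^ i) ((pdiff 1 ^^ (r - i)) F)))"
proof (induction r)
  case 0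
  then show ?case by simp
next
  case (Suc r)
  note lin = derivation_linear[OF derivation_dder[of t]]
  have "(dder t ^^ Suc r) F = (\<Sum>i\<le>r. of_nat (r choose i) *
      (Const ((- t) ^ i) * dder t ((pdiff 0 ^^ i) ((pdiff 1 ^^ (r - i)) F))))"
    by (simp add: Suc Const_linear_sum[OF lin] Const_linear_of_nat[OF lin] Const_linear_scale[OF lin])
  also have "\<dots> = (\<Sum>i\<le>r. of_nat (r choose i) *
      (Const ((- t) ^ Suc i) * (pdiff 0 ^^ Suc i) ((pdiff 1 ^^ (r - i)) F) +
       Const ((- t) ^ i) * (pdiff 0 ^^ i) ((pdiff 1 ^^ (Suc r - i)) F)))"
    by (intro sum.cong)
       (simp_all add: dder_def Suc_diff_le pdiff_funpow_commute Const_mult Const_uminus algebra_simps)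
  also have "\<dots> = (\<Sum>i\<le>Suc r. of_nat (Suc r choose i) *
      (Const ((- t) ^ i) * (pdiff 0 ^^ i) ((pdiff 1 ^^ (Suc r - i)) F)))"
    by (rule binomial_sum_Suc[symmetric])
  finally show ?case .
qed

text \<open>The variable \<open>x\<^sub>1\<close> has index \<open>1\<close>, and facts about it are stated with this numeral; the simplifier
should not turn it into \<open>Suc 0\<close>.\<close>

declare One_nat_def [simp del]

definition lin :: "'a::comm_semiring_1 \<Rightarrow> (nat, 'a) mpoly" where
  "lin t = Var 0 + Const t * Var 1"

lemma pdiff_Var: "pdiff i (Var j) = (if i = j then 1 else 0)"
  by (simp add: Var_def pdiff_single lookup_single_not_eq)

lemma pdiff_lin: "pdiff 0 (lin t) = 1" "pdiff 1 (lin t) = Const t"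
  by (simp_all add: lin_def Const_linear_add[OF Const_linear_pdiff]
      Const_linear_scale[OF Const_linear_pdiff] pdiff_Var)

lemma dder_lin: "dder e (lin t) = Const (t - e)"
  unfolding dder_def pdiff_lin by (simp add: Const_diff)

lemma Const_linear_pdiff_funpow:
  "Const_linear (\<lambda>F. (pdiff i ^^ m) ((pdiff j ^^ l) F))"
  by (rule Const_linear_compose[OF Const_linear_funpow[OF Const_linear_pdiff]
        Const_linear_funpow[OF Const_linear_pdiff]])

lemma Const_linear_transvectant_left: "Const_linear (\<lambda>E. transvectant e f r E F)"
proof (cases "r \<le> min e f")
  case True
  then show ?thesis
    unfolding transvectant_def
    by (simp only: if_True)
       (intro Const_linear_sum_fun Const_linear_mult_left Const_linear_mult_right
        Const_linear_pdiff_funpow)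
qed (auto simp: transvectant_def Const_linear_def)

lemma Const_linear_transvectant_right: "Const_linear (\<lambda>F. transvectant e f r E F)"
proof (cases "r \<le> min e f")
  case True
  then show ?thesis
    unfolding transvectant_def
    by (simp only: if_True)
       (intro Const_linear_sum_fun Const_linear_mult_left Const_linear_pdiff_funpow)
qed (auto simp: transvectant_def Const_linear_def)

text \<open>A derivative of order \<open>r\<close> of \<open>(x\<^sub>0 + e x\<^sub>1)\<^sup>d\<close> is a constant times the \<open>(d - r)\<close>-th power, with a factor
\<open>e\<close> for each differentiation by \<open>x\<^sub>1\<close>. Pulling the power out of the transvectant leaves the
binomial expansion of \<open>(\<partial>\<^sub>1 - e \<partial>\<^sub>0)\<^sup>r F\<close>.\<close>

lemma transvectant_power_left:
  fixes F :: "(nat, 'a::field_char_0) mpoly"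
  assumes "r \<le> d" "r \<le> f"
  shows "transvectant d f r (lin e ^ d) F =
    Const (fact (f - r) / fact f) * (lin e ^ (d - r) * (dder e ^^ r) F)"
proof -
  have E: "(pdiff 0 ^^ (r - i)) ((pdiff 1 ^^ i) (lin e ^ d)) =
      Const (fact d / fact (d - r)) * Const (e ^ i) * lin e ^ (d - r)" if "i \<le> r" for i
  proof -
    have "(pdiff 1 ^^ i) (lin e ^ d) = Const (fact d / fact (d - i) * e ^ i) * lin e ^ (d - i)"
      using assms that
      by (intro derivation_funpow_power[OF derivation_pdiff pdiff_lin(2)]) simp
    moreover have "(pdiff 0 ^^ (r - i)) (lin e ^ (d - i)) =
        Const (fact (d - i) / fact (d - i - (r - i)) * 1 ^ (r - i)) * lin e ^ (d - i - (r - i))"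
      using assms that
      by (intro derivation_funpow_power[OF derivation_pdiff]) (simp_all add: pdiff_lin(1))
    ultimately have "(pdiff 0 ^^ (r - i)) ((pdiff 1 ^^ i) (lin e ^ d)) =
        Const (fact d / fact (d - i) * e ^ i) *
          (Const (fact (d - i) / fact (d - r)) * lin e ^ (d - r))"
      using that
      by (simp add: Const_linear_scale[OF Const_linear_funpow[OF Const_linear_pdiff]] del: One_nat_def)
    moreover have "fact d / fact (d - i) * e ^ i * (fact (d - i) / fact (d - r)) =
        fact d / fact (d - r) * e ^ i"
      by simp
    ultimately show ?thesis
      by (simp only: Const_mult_assoc Const_mult[symmetric])
  qed
  have "(\<Sum>i\<le>r. Const ((- 1) ^ i * of_nat (r choose i)) *
              ((pdiff 0 ^^ (r - i)) ((pdiff 1 ^^ i) (lin e ^ d))) *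
              ((pdiff 0 ^^ i) ((pdiff 1 ^^ (r - i)) F))) =
     (\<Sum>i\<le>r. Const (fact d / fact (d - r)) * (lin e ^ (d - r) *
         (of_nat (r choose i) * (Const ((- e) ^ i) * (pdiff 0 ^^ i) ((pdiff 1 ^^ (r - i)) F)))))"
  proof (intro sum.cong refl)
    fix i assume i: "i \<in> {..r}"
    have "Const ((- e) ^ i) = (Const ((- 1) ^ i) * Const (e ^ i) :: (nat, 'a) mpoly)"
      by (simp only: power_minus[of e i] Const_mult)
    with i show "Const ((- 1) ^ i * of_nat (r choose i)) *
              ((pdiff 0 ^^ (r - i)) ((pdiff 1 ^^ i) (lin e ^ d))) *
              ((pdiff 0 ^^ i) ((pdiff 1 ^^ (r - i)) F)) =
        Const (fact d / fact (d - r)) * (lin e ^ (d - r) *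
         (of_nat (r choose i) * (Const ((- e) ^ i) * (pdiff 0 ^^ i) ((pdiff 1 ^^ (r - i)) F))))"
      by (simp only: E Const_mult Const_of_nat ac_simps atMost_iff)
  qed
  also have "\<dots> = Const (fact d / fact (d - r)) * (lin e ^ (d - r) * (dder e ^^ r) F)"
    unfolding dder_funpow sum_distrib_left ..
  finally have "transvectant d f r (lin e ^ d) F =
      Const ((fact (d - r) * fact (f - r)) / (fact d * fact f)) *
        (Const (fact d / fact (d - r)) * (lin e ^ (d - r) * (dder e ^^ r) F))"
    using assms by (simp add: transvectant_def)
  moreover have "(fact (d - r) * fact (f - r)) / (fact d * fact f) * (fact d / fact (d - r)) =
      (fact (f - r) / fact f :: 'a)"
    by simp
  ultimately show ?thesis
    by (simp only: Const_mult_assoc)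
qed

section \<open>Homogenised Legendre polynomials\<close>

text \<open>This is \<open>(u - v)\<^sup>s P\<^sub>s((u + v)/(u - v))\<close> for the Legendre polynomial \<open>P\<^sub>s\<close>.\<close>

definition legendre :: "nat \<Rightarrow> 'a::comm_ring_1 \<Rightarrow> 'a \<Rightarrow> 'a" where
  "legendre s u v = (\<Sum>j\<le>s. of_nat ((s choose j)\<^sup>2) * (v ^ j * u ^ (s - j)))"

lemma legendre_commute: "legendre s v u = legendre s u v"
  unfolding legendre_def
  by (rule sum.reindex_bij_witness[where i = "\<lambda>j. s - j" and j = "\<lambda>j. s - j"])
     (auto simp: binomial_symmetric[symmetric] mult.commute)

text \<open>The homogeneous polynomial in \<open>u\<close>, \<open>v\<close> with coefficient sequence \<open>f\<close>. Multiplication by \<open>u\<close> or \<open>v\<close>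
becomes an operation on sequences, so that identities can be checked coefficientwise.\<close>

definition bihom :: "nat \<Rightarrow> (nat \<Rightarrow> int) \<Rightarrow> 'a::comm_ring_1 \<Rightarrow> 'a \<Rightarrow> 'a" where
  "bihom n f u v = (\<Sum>j\<le>n. of_int (f j) * (v ^ j * u ^ (n - j)))"

lemma bihom_add: "bihom n f u v + bihom n g u v = bihom n (\<lambda>j. f j + g j) u v"
  by (simp add: bihom_def sum.distrib distrib_right)

lemma bihom_scale: "of_int c * bihom n f u v = bihom n (\<lambda>j. c * f j) u v"
  by (simp add: bihom_def sum_distrib_left mult.assoc)

lemma bihom_mult_fst:
  assumes "f (Suc n) = 0"
  shows "u * bihom n f u v = bihom (Suc n) f u v"
proof -
  have "u * bihom n f u v = (\<Sum>j\<le>n. of_int (f j) * (v ^ j * u ^ (Suc n - j)))"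
    unfolding bihom_def sum_distrib_left
    by (intro sum.cong refl) (simp add: Suc_diff_le ac_simps)
  with assms show ?thesis by (simp add: bihom_def)
qed

lemma bihom_mult_snd:
  "v * bihom n f u v = bihom (Suc n) (\<lambda>j. if j = 0 then 0 else f (j - 1)) u v"
  unfolding bihom_def sum.atMost_Suc_shift sum_distrib_left
  by (simp add: ac_simps)

lemma legendre_bihom: "legendre s u v = bihom s (\<lambda>j. int (s choose j) ^ 2) u v"
  by (simp add: legendre_def bihom_def)

lemma binomial_step: "(int n - int k) * int (n choose k) = int (Suc k) * int (n choose Suc k)"
proof (cases "k \<le> n")
  case True
  have "(n - k) * (n choose k) = Suc k * (n choose Suc k)"
    using binomial_absorption[of k n] binomial_absorb_comp[of n k] by simp
  then have "int (n - k) * int (n choose k) = int (Suc k) * int (n choose Suc k)"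
    by (metis of_nat_mult)
  with True show ?thesis by (simp add: of_nat_diff)
qed (simp add: binomial_eq_0)

text \<open>The three-term recurrence on coefficients. With \<open>x\<close>, \<open>y\<close>, \<open>z\<close> for three consecutive binomial
coefficients of \<open>t\<close>, all the others are sums of these by Pascal's rule, and the claim is a
combination of the two relations between neighbours \<open>(t - i) x = (i + 1) y\<close> and
\<open>(t - i - 1) y = (i + 2) z\<close>. These hold in the integers also beyond the end of the row, so the
end of the row needs no separate treatment.\<close>

lemma square_binomial_recurrence:
  "int (t + 2) * int (Suc (Suc t) choose Suc (Suc i)) ^ 2 +
     int (t + 1) * (int (t choose Suc (Suc i)) ^ 2 - 2 * int (t choose Suc i) ^ 2
        + int (t choose i) ^ 2) =
   int (2 * t + 3) * (int (Suc t choose Suc (Suc i)) ^ 2 + int (Suc t choose Suc i) ^ 2)"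
proof -
  define x y z where "x = int (t choose i)" and "y = int (t choose Suc i)"
    and "z = int (t choose Suc (Suc i))"
  have xy: "(int t - int i) * x = (int i + 1) * y"
    using binomial_step[of t i] by (simp add: x_def y_def algebra_simps)
  have yz: "(int t - int i - 1) * y = (int i + 2) * z"
    using binomial_step[of t "Suc i"] by (simp add: y_def z_def algebra_simps)
  have "(int t + 2) * (x + 2 * y + z) ^ 2 + (int t + 1) * (z ^ 2 - 2 * y ^ 2 + x ^ 2)
      - (2 * int t + 3) * ((y + z) ^ 2 + (x + y) ^ 2)
      = 2 * (y + z) * ((int t - int i) * x - (int i + 1) * y)
        - 2 * (x + y) * ((int t - int i - 1) * y - (int i + 2) * z)"
    by (simp add: algebra_simps power2_eq_square)
  with xy yz show ?thesis
    by (simp add: x_def y_def z_def algebra_simps)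
qed

text \<open>Bonnet's recurrence \<open>(s + 2) P\<^sub>s\<^sub>+\<^sub>2 + (s + 1) P\<^sub>s = (2 s + 3) x P\<^sub>s\<^sub>+\<^sub>1\<close>, homogenised by \<open>x = (u + v)/(u - v)\<close>.\<close>

lemma legendre_recurrence:
  fixes u v :: "'a::comm_ring_1"
  shows "of_nat (s + 2) * legendre (Suc (Suc s)) u v + of_nat (s + 1) * ((u - v)\<^sup>2 * legendre s u v) =
    of_nat (2 * s + 3) * ((u + v) * legendre (Suc s) u v)"
proof -
  let ?c = "\<lambda>s j. int (s choose j) ^ 2"
  let ?sh = "\<lambda>f j. if j = 0 then 0 else f (j - 1) :: int"
  let ?H = "\<lambda>n f. bihom n f u v"
  have uu: "u * (u * ?H s (?c s)) = ?H (Suc (Suc s)) (?c s)"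
    by (simp add: bihom_mult_fst)
  have uv: "v * (u * ?H s (?c s)) = ?H (Suc (Suc s)) (?sh (?c s))"
    by (simp add: bihom_mult_fst bihom_mult_snd)
  have vv: "v * (v * ?H s (?c s)) = ?H (Suc (Suc s)) (?sh (?sh (?c s)))"
    by (simp add: bihom_mult_snd)
  have square: "(u - v)\<^sup>2 * legendre s u v =
      ?H (Suc (Suc s)) (\<lambda>j. ?c s j - 2 * ?sh (?c s) j + ?sh (?sh (?c s)) j)"
  proof -
    have "(u - v)\<^sup>2 * legendre s u v =
        u * (u * ?H s (?c s)) + of_int (- 2) * (v * (u * ?H s (?c s))) + v * (v * ?H s (?c s))"
      by (simp add: legendre_bihom power2_eq_square algebra_simps)
    then show ?thesis
      unfolding uu uv vv bihom_scale bihom_add by simp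
  qed
  have sum: "(u + v) * legendre (Suc s) u v =
      ?H (Suc (Suc s)) (\<lambda>j. ?c (Suc s) j + ?sh (?c (Suc s)) j)"
    unfolding legendre_bihom distrib_right bihom_mult_snd bihom_add[symmetric]
    by (simp add: bihom_mult_fst binomial_eq_0)
  have coeff: "int (s + 2) * ?c (Suc (Suc s)) j +
      int (s + 1) * (?c s j - 2 * ?sh (?c s) j + ?sh (?sh (?c s)) j) =
      int (2 * s + 3) * (?c (Suc s) j + ?sh (?c (Suc s)) j)" for j
  proof -
    consider "j = 0" | "j = 1" | i where "j = Suc (Suc i)"
      by (metis One_nat_def not0_implies_Suc)
    then show ?thesis
    proof cases
      case 3
      then show ?thesis using square_binomial_recurrence[of s i] by simp
    qed (simp_all add: power2_eq_square algebra_simps One_nat_def)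
  qed
  have "of_nat (s + 2) * legendre (Suc (Suc s)) u v + of_nat (s + 1) * ((u - v)\<^sup>2 * legendre s u v) =
      of_int (int (s + 2)) * ?H (Suc (Suc s)) (?c (Suc (Suc s))) + of_int (int (s + 1)) *
        ?H (Suc (Suc s)) (\<lambda>j. ?c s j - 2 * ?sh (?c s) j + ?sh (?sh (?c s)) j)"
    unfolding square unfolding legendre_bihom of_int_of_nat_eq ..
  also have "\<dots> = of_int (int (2 * s + 3)) *
      ?H (Suc (Suc s)) (\<lambda>j. ?c (Suc s) j + ?sh (?c (Suc s)) j)"
    by (simp only: bihom_scale bihom_add coeff)
  also have "\<dots> = of_nat (2 * s + 3) * ((u + v) * legendre (Suc s) u v)"
    by (simp only: sum of_int_of_nat_eq)
  finally show ?thesis .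
qed

section \<open>The expansion of powers in Legendre polynomials\<close>

text \<open>The coefficient of \<open>P\<^sub>s\<close> in \<open>((1 + x)/2)\<^sup>d\<close> is \<open>2 s + 1\<close> times this number. The value \<open>0\<close> for \<open>s > d\<close>
allows the recurrence below to be uniform in \<open>s\<close>.\<close>

definition expansion_coeff :: "nat \<Rightarrow> nat \<Rightarrow> 'a::field_char_0" where
  "expansion_coeff d s = (if s \<le> d then (fact d)\<^sup>2 / (fact (d - s) * fact (d + s + 1)) else 0)"

text \<open>After dividing by the common factor \<open>F = d!\<^sup>2 / ((d + 1 - s)! (d + s + 2)!)\<close>, the claim is a polynomial
identity in \<open>d\<close> and \<open>s\<close>. The vanishing factors of the polynomials reproduce the default value \<open>0\<close>
at the boundary.\<close>

lemma expansion_coeff_Suc: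
  assumes "s \<le> Suc d"
  shows "of_nat (2 * s + 1) * expansion_coeff d s + of_nat s * expansion_coeff d (s - 1) +
      of_nat (s + 1) * expansion_coeff d (s + 1) =
      2 * (of_nat (2 * s + 1) * (expansion_coeff (Suc d) s :: 'a::field_char_0))"
proof -
  define D S where "D = (of_nat d :: 'a)" and "S = (of_nat s :: 'a)"
  define f0 f1 f2 g where "f0 = (fact (d + s) :: 'a)" and "f1 = (fact (d + s + 1) :: 'a)"
    and "f2 = (fact (d + s + 2) :: 'a)" and "g = (fact (Suc d - s) :: 'a)"
  define F :: 'a where "F = (fact d)\<^sup>2 / (g * f2)"
  have pos: "D + S + 1 \<noteq> 0" "D + S + 2 \<noteq> 0"
    using of_nat_neq_0[of "d + s", where 'a = 'a] of_nat_neq_0[of "d + s + 1", where 'a = 'a]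
    by (simp_all add: D_def S_def algebra_simps)
  have f2: "f2 = (D + S + 2) * f1"
    using fact_Suc[of "d + s + 1", where 'a = 'a]
    by (simp add: D_def S_def f1_def f2_def ac_simps One_nat_def del: fact_Suc)
  have f1: "f1 = (D + S + 1) * f0"
    by (simp add: D_def S_def f1_def f0_def algebra_simps One_nat_def)
  have nonzero: "f0 \<noteq> 0" "f1 \<noteq> 0" "f2 \<noteq> 0" "g \<noteq> 0"
    unfolding f0_def f1_def f2_def g_def by (rule fact_nonzero)+
  have "expansion_coeff d s = F * ((D + 1 - S) * (D + S + 2))"
  proof (cases "s \<le> d")
    case True
    then have "g = (D + 1 - S) * fact (d - s)" "D + 1 - S \<noteq> 0"
      using of_nat_neq_0[of "d - s", where 'a = 'a]
      by (simp_all add: Suc_diff_le of_nat_diff D_def S_def g_def algebra_simps)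
    moreover have "expansion_coeff d s = (fact d)\<^sup>2 / (fact (d - s) * f1)"
      using True unfolding expansion_coeff_def f1_def by (simp only: if_True)
    ultimately show ?thesis
      using pos by (simp add: F_def f2)
  next
    case False
    with assms have "s = Suc d" by simp
    then show ?thesis by (simp add: expansion_coeff_def D_def S_def)
  qed
  moreover have "S * expansion_coeff d (s - 1) = S * (F * ((D + S + 2) * (D + S + 1)))"
  proof (cases s)
    case (Suc t)
    with assms have "expansion_coeff d (s - 1) = (fact d)\<^sup>2 / (g * f0)"
      by (simp add: expansion_coeff_def g_def f0_def One_nat_def)
    with pos show ?thesis
      by (simp add: F_def f2 f1)
  qed (simp add: S_def)
  moreover have "expansion_coeff d (s + 1) = F * ((D + 1 - S) * (D - S))"
  proof (cases "s + 1 \<le> d")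
    case True
    then obtain t where t: "d = s + 1 + t" using le_Suc_ex by blast
    then have g: "g = (D + 1 - S) * ((D - S) * fact (d - (s + 1)))"
      by (simp add: D_def S_def g_def algebra_simps One_nat_def)
    have "D - S \<noteq> 0" "D + 1 - S \<noteq> 0"
      using t of_nat_neq_0[of t, where 'a = 'a] of_nat_neq_0[of "t + 1", where 'a = 'a]
      by (simp_all add: D_def S_def algebra_simps)
    moreover have "expansion_coeff d (s + 1) = (fact d)\<^sup>2 / (fact (d - (s + 1)) * f2)"
    proof -
      have "d + (s + 1) + 1 = d + s + 2" by simp
      with True show ?thesis unfolding expansion_coeff_def f2_def by (simp only: if_True)
    qed
    ultimately show ?thesis
      by (simp add: F_def g)
  next
    case False
    with assms have "s = d \<or> s = Suc d" by auto
    then show ?thesis by (auto simp add: expansion_coeff_def D_def S_def)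
  qed
  moreover have "expansion_coeff (Suc d) s = F * (D + 1)\<^sup>2"
  proof -
    have "Suc d + s + 1 = d + s + 2" by simp
    with assms have "expansion_coeff (Suc d) s = (fact (Suc d))\<^sup>2 / (g * f2)"
      unfolding expansion_coeff_def f2_def g_def by (simp only: if_True)
    then show ?thesis
      by (simp add: F_def D_def power_mult_distrib ac_simps)
  qed
  moreover have "of_nat (2 * s + 1) = 2 * S + 1" "of_nat (s + 1) = S + 1" "of_nat s = S"
    by (simp_all add: S_def)
  moreover have "(2 * S + 1) * (F * ((D + 1 - S) * (D + S + 2))) + S * (F * ((D + S + 2) * (D + S + 1)))
      + (S + 1) * (F * ((D + 1 - S) * (D - S))) = 2 * ((2 * S + 1) * (F * (D + 1)\<^sup>2))"
    by (simp add: algebra_simps power2_eq_square)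
  ultimately show ?thesis
    by (simp only:)
qed

text \<open>In the induction step \<open>2 u\<close> is split as \<open>(u - v) + (u + v)\<close>: the first summand raises the power of
\<open>u - v\<close>, the second acts on the Legendre polynomials by Bonnet's recurrence. Collecting the three
contributions to each \<open>(u - v)\<^sup>d\<^sup>+\<^sup>1\<^sup>-\<^sup>s Q\<^sub>s\<close> gives the recurrence of the coefficients.\<close>

lemma power_legendre_expansion:
  fixes u v :: "(nat, 'a::field_char_0) mpoly"
  shows "u ^ d = (\<Sum>s\<le>d. Const (of_nat (2 * s + 1) * expansion_coeff d s) *
                   ((u - v) ^ (d - s) * legendre s u v))"
proof (induction d)
  case 0
  then show ?case by (simp add: expansion_coeff_def legendre_def)
next
  case (Suc d)
  let ?b = "\<lambda>s. expansion_coeff d s :: 'a"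
  define X where "X s = (u - v) ^ (Suc d - s) * legendre s u v" for s
  have three_term: "Const (of_nat (2 * s + 1)) * ((u + v) * legendre s u v) =
      Const (of_nat (s + 1)) * legendre (s + 1) u v + Const (of_nat s) * ((u - v)\<^sup>2 * legendre (s - 1) u v)"
    for s
  proof (cases s)
    case 0
    then show ?thesis by (simp add: legendre_def One_nat_def)
  next
    case (Suc t)
    then have "2 * s + 1 = 2 * t + 3" by simp
    then have "Const (of_nat (2 * s + 1)) * ((u + v) * legendre s u v) =
        of_nat (2 * t + 3) * ((u + v) * legendre (Suc t) u v)"
      by (simp only: Const_of_nat Suc)
    also have "\<dots> = of_nat (t + 2) * legendre (Suc (Suc t)) u v + of_nat (t + 1) * ((u - v)\<^sup>2 * legendre t u v)"
      by (rule legendre_recurrence[symmetric])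
    also have "\<dots> = of_nat (s + 1) * legendre (s + 1) u v + of_nat s * ((u - v)\<^sup>2 * legendre (s - 1) u v)"
      using Suc by (simp add: One_nat_def)
    finally show ?thesis
      by (simp only: Const_of_nat)
  qed
  have "2 * u ^ Suc d = (\<Sum>s\<le>d. Const (?b s) * ((u - v) ^ (d - s) * ((u - v) *
      (Const (of_nat (2 * s + 1)) * legendre s u v) +
      Const (of_nat (2 * s + 1)) * ((u + v) * legendre s u v))))"
    unfolding power_Suc Suc.IH sum_distrib_left
    by (intro sum.cong refl, simp only: Const_mult) (simp add: algebra_simps)
  also have "\<dots> = (\<Sum>s\<le>d. Const (of_nat (2 * s + 1) * ?b s) * X s
      + Const (of_nat (s + 1) * ?b s) * X (s + 1) + Const (of_nat s * ?b s) * X (s - 1))"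
  proof (intro sum.cong refl)
    fix s assume "s \<in> {..d}"
    then have s: "s \<le> d" by simp
    have X0: "(u - v) ^ (d - s) * ((u - v) * legendre s u v) = X s"
      using s by (simp add: X_def Suc_diff_le)
    have X1: "(u - v) ^ (d - s) * legendre (s + 1) u v = X (s + 1)"
      by (simp add: X_def)
    have X2: "Const (of_nat s) * ((u - v) ^ (d - s) * ((u - v)\<^sup>2 * legendre (s - 1) u v)) =
        Const (of_nat s) * X (s - 1)"
    proof (cases s)
      case (Suc t)
      with s have "Suc d - (s - 1) = d - s + 2" by simp
      then show ?thesis by (simp add: X_def power2_eq_square mult.assoc)
    qed simp
    have "Const (?b s) * ((u - v) ^ (d - s) * ((u - v) *
          (Const (of_nat (2 * s + 1)) * legendre s u v) +
          Const (of_nat (2 * s + 1)) * ((u + v) * legendre s u v))) =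
        Const (of_nat (2 * s + 1)) * Const (?b s) * ((u - v) ^ (d - s) * ((u - v) * legendre s u v)) +
        Const (of_nat (s + 1)) * Const (?b s) * ((u - v) ^ (d - s) * legendre (s + 1) u v) +
        Const (?b s) * (Const (of_nat s) * ((u - v) ^ (d - s) * ((u - v)\<^sup>2 * legendre (s - 1) u v)))"
      unfolding three_term by (simp only: distrib_left ac_simps)
    then show "Const (?b s) * ((u - v) ^ (d - s) * ((u - v) *
          (Const (of_nat (2 * s + 1)) * legendre s u v) +
          Const (of_nat (2 * s + 1)) * ((u + v) * legendre s u v))) =
        Const (of_nat (2 * s + 1) * ?b s) * X s
      + Const (of_nat (s + 1) * ?b s) * X (s + 1) + Const (of_nat s * ?b s) * X (s - 1)"
      unfolding X0 X1 X2 Const_mult by (simp only: ac_simps)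
  qed
  also have "\<dots> = (\<Sum>s\<le>Suc d. Const (of_nat (2 * s + 1) * ?b s) * X s) +
      (\<Sum>s\<le>Suc d. Const (of_nat s * ?b (s - 1)) * X s) +
      (\<Sum>s\<le>Suc d. Const (of_nat (s + 1) * ?b (s + 1)) * X s)"
  proof -
    have beyond: "?b (Suc d) = 0" "?b (Suc (Suc d)) = 0"
      by (simp_all add: expansion_coeff_def)
    have "(\<Sum>s\<le>d. Const (of_nat (2 * s + 1) * ?b s) * X s) =
        (\<Sum>s\<le>Suc d. Const (of_nat (2 * s + 1) * ?b s) * X s)"
      by (simp add: beyond)
    moreover have "(\<Sum>s\<le>d. Const (of_nat (s + 1) * ?b s) * X (s + 1)) =
        (\<Sum>s\<le>Suc d. Const (of_nat s * ?b (s - 1)) * X s)"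
      unfolding sum.atMost_Suc_shift by (simp add: One_nat_def ac_simps)
    moreover have "(\<Sum>s\<le>d. Const (of_nat s * ?b s) * X (s - 1)) =
        (\<Sum>s\<le>Suc d. Const (of_nat (s + 1) * ?b (s + 1)) * X s)"
    proof -
      have "(\<Sum>s\<le>d. Const (of_nat s * ?b s) * X (s - 1)) =
          (\<Sum>s\<le>Suc (Suc d). Const (of_nat s * ?b s) * X (s - 1))"
        by (simp add: beyond)
      also have "\<dots> = (\<Sum>s\<le>Suc d. Const (of_nat (Suc s) * ?b (Suc s)) * X (Suc s - 1))"
        unfolding sum.atMost_Suc_shift[of _ "Suc d"] by simp
      finally show ?thesis by (simp add: One_nat_def ac_simps)
    qed
    ultimately show ?thesis
      by (simp only: sum.distrib)
  qed
  also have "\<dots> = (\<Sum>s\<le>Suc d. Const (of_nat (2 * s + 1) * ?b s + of_nat s * ?b (s - 1) +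
      of_nat (s + 1) * ?b (s + 1)) * X s)"
    by (simp only: Const_add distrib_right sum.distrib)
  also have "\<dots> = (\<Sum>s\<le>Suc d. Const 2 * (Const (of_nat (2 * s + 1) * expansion_coeff (Suc d) s) * X s))"
    by (intro sum.cong refl) (simp only: atMost_iff expansion_coeff_Suc Const_mult_assoc)
  finally have "Const (1 / 2) * (2 * u ^ Suc d) = Const (1 / 2) *
      (Const 2 * (\<Sum>s\<le>Suc d. Const (of_nat (2 * s + 1) * expansion_coeff (Suc d) s) * X s))"
    by (simp only: sum_distrib_left)
  moreover have "2 * u ^ Suc d = Const 2 * u ^ Suc d"
    by (simp only: Const_numeral)
  ultimately show ?case
    unfolding X_def by (simp only: Const_mult_assoc) simp
qed

text \<open>Exchanging \<open>u\<close> and \<open>v\<close> changes the sign of the terms with \<open>d - s\<close> odd and fixes the others, so the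
difference keeps the former, doubled. They are indexed by \<open>r\<close> with \<open>d - s = 2 r + 1\<close>.\<close>

lemma power_diff_legendre_expansion:
  fixes u v :: "(nat, 'a::field_char_0) mpoly"
  shows "u ^ d - v ^ d = (\<Sum>r | 2 * r + 1 \<le> d.
     Const (2 * (of_nat (2 * (d - (2 * r + 1)) + 1) * expansion_coeff d (d - (2 * r + 1)))) *
       ((u - v) ^ (2 * r + 1) * legendre (d - (2 * r + 1)) u v))"
proof -
  let ?a = "\<lambda>s. of_nat (2 * s + 1) * expansion_coeff d s :: 'a"
  have v: "v ^ d = (\<Sum>s\<le>d. Const (?a s) * ((- 1) ^ (d - s) * ((u - v) ^ (d - s) * legendre s u v)))"
  proof -
    have "v - u = - 1 * (u - v)" by simp
    then have "(v - u) ^ k = (- 1) ^ k * (u - v) ^ k" for k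
      by (simp only: power_mult_distrib)
    then show ?thesis
      using power_legendre_expansion[of v d u] by (simp only: legendre_commute[of _ v u] mult.assoc)
  qed
  have double: "C * X - C * (- 1 * X) = 2 * C * X" for C X :: "(nat, 'a) mpoly"
    by simp
  have "u ^ d - v ^ d = (\<Sum>s\<le>d. Const (?a s) * ((u - v) ^ (d - s) * legendre s u v)
      - Const (?a s) * ((- 1) ^ (d - s) * ((u - v) ^ (d - s) * legendre s u v)))"
    unfolding sum_subtractf v using power_legendre_expansion[of u d v] by simp
  also have "\<dots> = (\<Sum>s\<in>{s. s \<le> d \<and> odd (d - s)}. Const (2 * ?a s) * ((u - v) ^ (d - s) * legendre s u v))"
  proof (rule sum.mono_neutral_cong_right)
    show "\<forall>s\<in>{..d} - {s. s \<le> d \<and> odd (d - s)}.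
        Const (?a s) * ((u - v) ^ (d - s) * legendre s u v) -
        Const (?a s) * ((- 1) ^ (d - s) * ((u - v) ^ (d - s) * legendre s u v)) = 0"
    proof
      fix s assume "s \<in> {..d} - {s. s \<le> d \<and> odd (d - s)}"
      then have "(- 1 :: (nat, 'a) mpoly) ^ (d - s) = 1" by (intro neg_one_even_power) simp
      then show "Const (?a s) * ((u - v) ^ (d - s) * legendre s u v) -
        Const (?a s) * ((- 1) ^ (d - s) * ((u - v) ^ (d - s) * legendre s u v)) = 0"
        by (simp only: mult_1 diff_self)
    qed
  next
    fix s assume "s \<in> {s. s \<le> d \<and> odd (d - s)}"
    then have "(- 1 :: (nat, 'a) mpoly) ^ (d - s) = - 1" by (intro neg_one_odd_power) simp
    then show "Const (?a s) * ((u - v) ^ (d - s) * legendre s u v) -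
        Const (?a s) * ((- 1) ^ (d - s) * ((u - v) ^ (d - s) * legendre s u v)) =
        Const (2 * ?a s) * ((u - v) ^ (d - s) * legendre s u v)"
      by (simp only: double Const_mult[of 2] Const_numeral)
  qed auto
  also have "\<dots> = (\<Sum>r | 2 * r + 1 \<le> d. Const (2 * ?a (d - (2 * r + 1))) *
       ((u - v) ^ (2 * r + 1) * legendre (d - (2 * r + 1)) u v))"
  proof (rule sum.reindex_bij_witness[where i = "\<lambda>r. d - (2 * r + 1)" and j = "\<lambda>s. (d - s) div 2"])
    fix s assume "s \<in> {s. s \<le> d \<and> odd (d - s)}"
    then have half: "2 * ((d - s) div 2) + 1 = d - s" and le: "s \<le> d"
      using odd_two_times_div_two_succ[of "d - s"] by simp_all
    show "d - (2 * ((d - s) div 2) + 1) = s" "(d - s) div 2 \<in> {r. 2 * r + 1 \<le> d}"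
      using half le by simp_all
    show "Const (2 * ?a (d - (2 * ((d - s) div 2) + 1))) * ((u - v) ^ (2 * ((d - s) div 2) + 1) *
        legendre (d - (2 * ((d - s) div 2) + 1)) u v) =
        Const (2 * ?a s) * ((u - v) ^ (d - s) * legendre s u v)"
      unfolding half using le by simp
  qed auto
  finally show ?thesis .
qed

section \<open>The trilinear identity\<close>

lemma transvectant_powers:
  fixes l m :: "'a::field_char_0"
  assumes "r \<le> d"
  shows "transvectant d d r (lin l ^ d) (lin m ^ d) =
    Const ((m - l) ^ r) * (lin l ^ (d - r) * lin m ^ (d - r))"
proof -
  have "(dder l ^^ r) (lin m ^ d) = Const (fact d / fact (d - r) * (m - l) ^ r) * lin m ^ (d - r)"
    using assms by (rule derivation_funpow_power[OF derivation_dder dder_lin])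
  then have "transvectant d d r (lin l ^ d) (lin m ^ d) =
      Const (fact (d - r) / fact d) * (Const (fact d / fact (d - r) * (m - l) ^ r) *
        (lin l ^ (d - r) * lin m ^ (d - r)))"
    using assms by (simp add: transvectant_power_left mult.left_commute)
  then show ?thesis
    unfolding Const_mult_assoc by simp
qed

text \<open>By the Leibniz rule, \<open>j\<close> derivatives hit the first factor and \<open>s - j\<close> the second. The falling
factorials that they produce combine with the binomial coefficient of the Leibniz rule to
\<open>s!\<close> times its square, which is how the Legendre polynomial arises.\<close>

lemma dder_funpow_powers:
  fixes e l m :: "'a::field_char_0"
  shows "(dder e ^^ s) (lin l ^ s * lin m ^ s) =
    Const (fact s) * legendre s (Const (m - e) * lin l) (Const (l - e) * lin m)"
proof -
  let ?u = "Const (m - e) * lin l" and ?v = "Const (l - e) * lin m"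
  have "(dder e ^^ s) (lin l ^ s * lin m ^ s) =
      (\<Sum>j\<le>s. of_nat (s choose j) * ((dder e ^^ j) (lin l ^ s) * (dder e ^^ (s - j)) (lin m ^ s)))"
    by (rule derivation_funpow_mult[OF derivation_dder])
  also have "\<dots> = (\<Sum>j\<le>s. Const (fact s) * (of_nat ((s choose j)\<^sup>2) * (?v ^ j * ?u ^ (s - j))))"
  proof (intro sum.cong refl)
    fix j assume "j \<in> {..s}"
    then have j: "j \<le> s" by simp
    have 1: "(dder e ^^ j) (lin l ^ s) = Const (fact s / fact (s - j) * (l - e) ^ j) * lin l ^ (s - j)"
      using j by (rule derivation_funpow_power[OF derivation_dder dder_lin])
    have "(dder e ^^ (s - j)) (lin m ^ s) =
        Const (fact s / fact (s - (s - j)) * (m - e) ^ (s - j)) * lin m ^ (s - (s - j))"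
      by (rule derivation_funpow_power[OF derivation_dder dder_lin]) simp
    then have 2: "(dder e ^^ (s - j)) (lin m ^ s) =
        Const (fact s / fact j * (m - e) ^ (s - j)) * lin m ^ j"
      using j by simp
    \<comment> \<open>The falling factorials from the two factors; the remaining binomial coefficient makes the square.\<close>
    have binomial: "fact s / fact (s - j) * (fact s / fact j) = fact s * (of_nat (s choose j) :: 'a)"
      using j by (simp add: binomial_fact)
    have "of_nat (s choose j) * ((dder e ^^ j) (lin l ^ s) * (dder e ^^ (s - j)) (lin m ^ s)) =
        Const (of_nat (s choose j) * (fact s / fact (s - j) * (fact s / fact j))) * (?v ^ j * ?u ^ (s - j))"
      unfolding 1 2 Const_mult power_mult_distrib Const_power Const_of_nat by (simp only: ac_simps)
    also have "\<dots> = Const (fact s) * (of_nat ((s choose j)\<^sup>2) * (?v ^ j * ?u ^ (s - j)))"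
      unfolding binomial Const_mult of_nat_power power2_eq_square Const_of_nat of_nat_mult
      by (simp only: ac_simps)
    finally show "of_nat (s choose j) * ((dder e ^^ j) (lin l ^ s) * (dder e ^^ (s - j)) (lin m ^ s)) =
        Const (fact s) * (of_nat ((s choose j)\<^sup>2) * (?v ^ j * ?u ^ (s - j)))" .
  qed
  finally show ?thesis
    by (simp only: legendre_def sum_distrib_left)
qed

text \<open>The Pluecker relation between three linear forms in two variables.\<close>

lemma lin_relation:
  fixes e l m :: "'a::comm_ring_1"
  shows "Const (m - e) * lin l - Const (l - e) * lin m = Const (m - l) * lin e"
  by (simp add: lin_def Const_diff algebra_simps)

definition beta_coeff :: "nat \<Rightarrow> nat \<Rightarrow> 'a::field_char_0" where
  "beta_coeff d r = 2 * of_nat (d choose (2 * r + 1)) ^ 2 / of_nat ((2 * d - 2 * r) choose (2 * r + 1))"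

text \<open>The two factors besides \<open>c\<^sub>r\<close> come from the inner Leibniz rule and from the normalisation of the outer
transvectant. With \<open>s = d - 2 r - 1\<close> the lower binomial coefficient in \<open>c\<^sub>r\<close> is \<open>d + s + 1\<close> over
\<open>d - s\<close>, and everything cancels to twice the coefficient of the Legendre expansion.\<close>

lemma beta_coeff_expansion_coeff:
  assumes "2 * r + 1 \<le> d"
  shows "beta_coeff d r * (fact (d - (2 * r + 1)) * (fact (d - (2 * r + 1)) / fact (2 * (d - (2 * r + 1))))) =
    2 * (of_nat (2 * (d - (2 * r + 1)) + 1) * (expansion_coeff d (d - (2 * r + 1)) :: 'a::field_char_0))"
proof -
  define k s where "k = 2 * r + 1" and "s = d - k"
  have d: "d = s + k" "2 * d - 2 * r = s + d + 1" "s + d + 1 - k = 2 * s + 1"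
    using assms by (simp_all add: k_def s_def)
  have 1: "(of_nat (d choose k) :: 'a) = fact d / (fact k * fact s)"
    by (simp add: binomial_fact d(1))
  have 2: "(of_nat ((2 * d - 2 * r) choose k) :: 'a) = fact (s + d + 1) / (fact k * fact (2 * s + 1))"
    unfolding d(2) d(3)[symmetric] by (rule binomial_fact) (simp add: d(1))
  have "d + s + 1 = s + d + 1" "d - s = k" "s \<le> d" using d(1) by simp_all
  then have 3: "(expansion_coeff d s :: 'a) = (fact d)\<^sup>2 / (fact k * fact (s + d + 1))"
    by (simp only: expansion_coeff_def if_True)
  have 4: "(fact (2 * s + 1) :: 'a) = of_nat (2 * s + 1) * fact (2 * s)"
    using fact_Suc[of "2 * s", where 'a = 'a] by (simp del: fact_Suc add: One_nat_def)
  have "beta_coeff d r * (fact s * (fact s / fact (2 * s))) =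
      2 * (of_nat (2 * s + 1) * (expansion_coeff d s :: 'a))"
    unfolding beta_coeff_def k_def[symmetric] 1 2 3 4
    by (simp add: power2_eq_square field_simps del: fact_Suc of_nat_Suc of_nat_add of_nat_mult)
  then show ?thesis by (simp only: s_def k_def)
qed

text \<open>The difference of the two sides of the trilinear identity, packaged as one map to which the
principle for linear maps on forms applies in each argument.\<close>

definition trilinear_defect ::
  "nat \<Rightarrow> (nat, 'a::field_char_0) mpoly \<Rightarrow> (nat, 'a) mpoly \<Rightarrow> (nat, 'a) mpoly \<Rightarrow> (nat, 'a) mpoly" where
  "trilinear_defect d E A B =
     (\<Sum>r | 2 * r + 1 \<le> d. Const (beta_coeff d r) *
        transvectant d (2 * d - 2 * (2 * r + 1)) (d - 2 * r - 1) E (transvectant d d (2 * r + 1) A B))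
     - (transvectant d d d E B * A - transvectant d d d E A * B)"

text \<open>On powers of linear forms, the full transvectants are \<open>(E, B)\<^sub>d = (m - e)\<^sup>d\<close> and \<open>(E, A)\<^sub>d = (l - e)\<^sup>d\<close>, so
the right side is \<open>u\<^sup>d - v\<^sup>d\<close>. On the left, \<open>(A, B)\<^sub>k\<close> contributes \<open>(m - l)\<^sup>k\<close> and the outer transvectant
contributes \<open>(x\<^sub>0 + e x\<^sub>1)\<^sup>k\<close>; by the Pluecker relation their product is \<open>(u - v)\<^sup>k\<close>.\<close>

lemma trilinear_defect_powers:
  fixes e l m :: "'a::field_char_0"
  shows "trilinear_defect d (lin e ^ d) (lin l ^ d) (lin m ^ d) = 0"
proof -
  define u v where "u = Const (m - e) * lin l" and "v = Const (l - e) * lin m"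
  have "Const (beta_coeff d r) * transvectant d (2 * d - 2 * (2 * r + 1)) (d - 2 * r - 1) (lin e ^ d)
          (transvectant d d (2 * r + 1) (lin l ^ d) (lin m ^ d)) =
      Const (2 * (of_nat (2 * (d - (2 * r + 1)) + 1) * expansion_coeff d (d - (2 * r + 1)))) *
       ((u - v) ^ (2 * r + 1) * legendre (d - (2 * r + 1)) u v)"
    if r: "2 * r + 1 \<le> d" for r
  proof -
    define k s where "k = 2 * r + 1" and "s = d - k"
    have idx: "d - 2 * r - 1 = s" "2 * d - 2 * k = 2 * s"
      and sk: "s \<le> d" "d - s = k" "k \<le> d"
      using r by (simp_all add: k_def s_def)
    have "transvectant d (2 * s) s (lin e ^ d) (transvectant d d k (lin l ^ d) (lin m ^ d)) =
        Const ((m - l) ^ k) * transvectant d (2 * s) s (lin e ^ d) (lin l ^ s * lin m ^ s)"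
      unfolding transvectant_powers[OF sk(3)] s_def[symmetric]
      by (rule Const_linear_scale[OF Const_linear_transvectant_right])
    also have "transvectant d (2 * s) s (lin e ^ d) (lin l ^ s * lin m ^ s) =
        Const (fact s / fact (2 * s)) * (lin e ^ k * (Const (fact s) * legendre s u v))"
      using transvectant_power_left[of s d "2 * s" e "lin l ^ s * lin m ^ s"] sk
      by (simp add: dder_funpow_powers u_def v_def)
    also have "Const ((m - l) ^ k) * \<dots> =
        Const (fact s * (fact s / fact (2 * s))) * ((u - v) ^ k * legendre s u v)"
      unfolding u_def v_def lin_relation Const_mult Const_power power_mult_distrib
      by (simp only: ac_simps)
    finally show ?thesis
      using beta_coeff_expansion_coeff[OF r, where 'a = 'a]
      unfolding idx(1) k_def[symmetric] unfolding idx(2) s_def[symmetric]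
      by (simp only: Const_mult_assoc)
  qed
  then have "(\<Sum>r | 2 * r + 1 \<le> d. Const (beta_coeff d r) *
        transvectant d (2 * d - 2 * (2 * r + 1)) (d - 2 * r - 1) (lin e ^ d)
          (transvectant d d (2 * r + 1) (lin l ^ d) (lin m ^ d))) = u ^ d - v ^ d"
    unfolding power_diff_legendre_expansion by (intro sum.cong refl) simp
  then show ?thesis
    by (simp add: trilinear_defect_def transvectant_powers u_def v_def power_mult_distrib Const_power)
qed

definition basis_form :: "nat \<Rightarrow> nat \<Rightarrow> (nat, 'a::comm_semiring_1) mpoly" where
  "basis_form d p = Const (of_nat (d choose p)) * Var 0 ^ (d - p) * Var 1 ^ p"

lemma form_basis: "form d a = (\<Sum>p\<le>d. Const (a p) * basis_form d p)"
  unfolding form_def basis_form_def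
  by (intro sum.cong refl) (simp only: Const_mult ac_simps)

lemma Const_linear_form:
  "Const_linear \<Phi> \<Longrightarrow> \<Phi> (form d a) = (\<Sum>p\<le>d. Const (a p) * \<Phi> (basis_form d p))"
  by (simp only: form_basis Const_linear_sum Const_linear_scale)

lemma lin_power_basis: "lin t ^ d = (\<Sum>p\<le>d. Const (t ^ p) * basis_form d p)"
proof -
  have "lin t ^ d = (Const t * Var 1 + Var 0) ^ d"
    by (simp only: lin_def add.commute)
  also have "\<dots> = (\<Sum>p\<le>d. of_nat (d choose p) * (Const t * Var 1) ^ p * Var 0 ^ (d - p))"
    by (rule binomial_ring)
  also have "\<dots> = (\<Sum>p\<le>d. Const (t ^ p) * basis_form d p)"
    unfolding basis_form_def
    by (intro sum.cong refl)
       (simp only: Const_of_nat Const_power power_mult_distrib ac_simps)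
  finally show ?thesis .
qed

text \<open>Each coefficient of the sum is a polynomial in \<open>t\<close> that vanishes at every point of an infinite
field.\<close>

lemma vanishing_power_sums:
  fixes N :: "nat \<Rightarrow> ('v, 'a::field_char_0) mpoly"
  assumes zero: "\<And>t. (\<Sum>p\<le>d. Const (t ^ p) * N p) = 0" and "p \<le> d"
  shows "N p = 0"
proof (rule poly_mapping_eqI)
  fix \<mu>
  let ?P = "\<Sum>q\<le>d. monom (Poly_Mapping.lookup (N q) \<mu>) q"
  have "poly ?P t = 0" for t
    using arg_cong[OF zero[of t], of "\<lambda>F. Poly_Mapping.lookup F \<mu>"]
    by (simp add: lookup_sum lookup_Const_mult poly_sum poly_monom) (simp add: mult.commute)
  then have "?P = 0"
    by (intro poly_eq_poly_eq_iff[THEN iffD1] ext) simp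
  then have "coeff ?P p = 0" by simp
  then show "Poly_Mapping.lookup (N p) \<mu> = Poly_Mapping.lookup 0 \<mu>"
    using \<open>p \<le> d\<close> by (simp add: coeff_sum)
qed

text \<open>The powers of the linear forms \<open>x\<^sub>0 + t x\<^sub>1\<close> span the forms of order \<open>d\<close>.\<close>

lemma Const_linear_vanish_form:
  fixes \<Phi> :: "(nat, 'a::field_char_0) mpoly \<Rightarrow> (nat, 'a) mpoly"
  assumes lin: "Const_linear \<Phi>" and powers: "\<And>t. \<Phi> (lin t ^ d) = 0"
  shows "\<Phi> (form d a) = 0"
proof -
  have "\<Phi> (basis_form d p) = 0" if "p \<le> d" for p
  proof (rule vanishing_power_sums[OF _ that])
    show "(\<Sum>p\<le>d. Const (t ^ p) * \<Phi> (basis_form d p)) = 0" for t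
      using powers[of t] by (simp add: lin_power_basis Const_linear_sum[OF lin] Const_linear_scale[OF lin])
  qed
  then show ?thesis by (simp add: Const_linear_form[OF lin])
qed

lemma trilinear_defect_zero:
  fixes e a b :: "nat \<Rightarrow> 'a::field_char_0"
  shows "trilinear_defect d (form d e) (form d a) (form d b) = 0"
proof -
  have E: "Const_linear (\<lambda>E. trilinear_defect d E A B)" for A B :: "(nat, 'a) mpoly"
    unfolding trilinear_defect_def
    by (rule Const_linear_diff[OF Const_linear_sum_fun[OF Const_linear_mult_left]
          Const_linear_diff[OF Const_linear_mult_right Const_linear_mult_right]];
        rule Const_linear_transvectant_left)
  have A: "Const_linear (\<lambda>A. trilinear_defect d E A B)" for E B :: "(nat, 'a) mpoly"
    unfolding trilinear_defect_def
    by (rule Const_linear_diff[OF Const_linear_sum_fun[OF Const_linear_mult_left[OF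
            Const_linear_compose[OF Const_linear_transvectant_right Const_linear_transvectant_left]]]
          Const_linear_diff[OF Const_linear_mult_left[OF Const_linear_id]
            Const_linear_mult_right[OF Const_linear_transvectant_right]]])
  have B: "Const_linear (\<lambda>B. trilinear_defect d E A B)" for E A :: "(nat, 'a) mpoly"
    unfolding trilinear_defect_def
    by (rule Const_linear_diff[OF Const_linear_sum_fun[OF Const_linear_mult_left[OF
            Const_linear_compose[OF Const_linear_transvectant_right Const_linear_transvectant_right]]]
          Const_linear_diff[OF Const_linear_mult_right[OF Const_linear_transvectant_right]
            Const_linear_mult_left[OF Const_linear_id]]])
  \<comment> \<open>Replace the powers of linear forms by arbitrary forms, one argument at a time.\<close>
  have "trilinear_defect d (lin s ^ d) (lin t ^ d) (form d b) = 0" for s t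
    using B trilinear_defect_powers by (rule Const_linear_vanish_form)
  then have "trilinear_defect d (lin s ^ d) (form d a) (form d b) = 0" for s
    by (rule Const_linear_vanish_form[OF A])
  then show ?thesis
    by (rule Const_linear_vanish_form[OF E])
qed

section \<open>The full transvectant of two forms\<close>

text \<open>For powers of linear forms the full transvectant is \<open>(t - s)\<^sup>d\<close>. Comparing coefficients of \<open>t\<^sup>p\<close> and
then of \<open>s\<^sup>q\<close> yields its values on monomials without differentiating monomials.\<close>

lemma transvectant_full_basis:
  assumes "p \<le> d" "q \<le> d"
  shows "transvectant d d d (basis_form d q) (basis_form d p :: (nat, 'a::field_char_0) mpoly) =
    (if q = d - p then Const ((- 1) ^ (d - p) * of_nat (d choose p)) else 0)"
proof -
  have left: "transvectant d d d (lin s ^ d) (basis_form d p) =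
      Const (of_nat (d choose p) * (- s) ^ (d - p))" for s :: 'a
  proof -
    let ?N = "\<lambda>p. transvectant d d d (lin s ^ d) (basis_form d p) - Const (of_nat (d choose p) * (- s) ^ (d - p))"
    have "?N p = 0"
    proof (rule vanishing_power_sums[OF _ \<open>p \<le> d\<close>])
      fix t
      have "(\<Sum>p\<le>d. Const (t ^ p) * transvectant d d d (lin s ^ d) (basis_form d p)) =
          transvectant d d d (lin s ^ d) (lin t ^ d)"
        unfolding lin_power_basis[of t]
        by (simp only: Const_linear_sum[OF Const_linear_transvectant_right]
            Const_linear_scale[OF Const_linear_transvectant_right])
      also have "\<dots> = Const ((t + - s) ^ d)"
        by (simp add: transvectant_powers)
      also have "\<dots> = (\<Sum>p\<le>d. Const (t ^ p) * Const (of_nat (d choose p) * (- s) ^ (d - p)))"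
        unfolding Const_power Const_add unfolding binomial_ring Const_mult Const_of_nat Const_power
        by (simp only: ac_simps)
      finally show "(\<Sum>p\<le>d. Const (t ^ p) * ?N p) = 0"
        by (simp add: algebra_simps sum_subtractf)
    qed
    then show ?thesis by simp
  qed
  let ?N = "\<lambda>q. transvectant d d d (basis_form d q) (basis_form d p :: (nat, 'a) mpoly) -
    (if q = d - p then Const ((- 1) ^ (d - p) * of_nat (d choose p)) else 0)"
  have "?N q = 0"
  proof (rule vanishing_power_sums[OF _ \<open>q \<le> d\<close>])
    fix s :: 'a
    have "(\<Sum>q\<le>d. Const (s ^ q) * transvectant d d d (basis_form d q) (basis_form d p)) =
        transvectant d d d (lin s ^ d) (basis_form d p)"
      unfolding lin_power_basis
      by (simp only: Const_linear_sum[OF Const_linear_transvectant_left]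
          Const_linear_scale[OF Const_linear_transvectant_left])
    also have "\<dots> = Const (s ^ (d - p)) * Const ((- 1) ^ (d - p) * of_nat (d choose p))"
      unfolding left power_minus[of s] Const_mult by (simp only: ac_simps)
    also have "\<dots> = (\<Sum>q\<le>d. Const (s ^ q) *
        (if q = d - p then Const ((- 1) ^ (d - p) * of_nat (d choose p)) else 0))"
      by (simp add: if_distrib cong: if_cong)
    finally show "(\<Sum>q\<le>d. Const (s ^ q) * ?N q) = 0"
      by (simp only: right_diff_distrib sum_subtractf diff_self)
  qed
  then show ?thesis by simp
qed

lemma transvectant_full_form:
  fixes e b :: "nat \<Rightarrow> 'a::field_char_0"
  shows "transvectant d d d (form d e) (form d b) =
    Const (\<Sum>p\<le>d. (- 1) ^ (d - p) * of_nat (d choose p) * e (d - p) * b p)"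
proof -
  have "transvectant d d d (form d e) (form d b) =
      (\<Sum>p\<le>d. \<Sum>q\<le>d. Const (b p) * (Const (e q) * transvectant d d d (basis_form d q) (basis_form d p)))"
    by (simp only: Const_linear_form[OF Const_linear_transvectant_right]
        Const_linear_form[OF Const_linear_transvectant_left] sum_distrib_left)
  also have "\<dots> = (\<Sum>p\<le>d. \<Sum>q\<le>d. if q = d - p
      then Const (b p) * (Const (e q) * Const ((- 1) ^ (d - p) * of_nat (d choose p))) else 0)"
    by (intro sum.cong refl) (simp add: transvectant_full_basis)
  also have "\<dots> = (\<Sum>p\<le>d. Const (b p) * (Const (e (d - p)) * Const ((- 1) ^ (d - p) * of_nat (d choose p))))"
    by simp
  also have "\<dots> = (\<Sum>p\<le>d. Const ((- 1) ^ (d - p) * of_nat (d choose p) * e (d - p) * b p))"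
    by (simp only: Const_mult ac_simps)
  also have "\<dots> = Const (\<Sum>p\<le>d. (- 1) ^ (d - p) * of_nat (d choose p) * e (d - p) * b p)"
    by (simp only: Const_sum)
  finally show ?thesis .
qed

section \<open>Evaluation, the Euler identity and the evectant\<close>

definition monomial_value :: "('v \<Rightarrow> 'b::comm_semiring_1) \<Rightarrow> ('v \<Rightarrow>\<^sub>0 nat) \<Rightarrow> 'b" where
  "monomial_value v m = (\<Prod>i\<in>Poly_Mapping.keys m. v i ^ Poly_Mapping.lookup m i)"

lemma monomial_value_superset:
  "finite I \<Longrightarrow> Poly_Mapping.keys m \<subseteq> I \<Longrightarrow>
     monomial_value v m = (\<Prod>i\<in>I. v i ^ Poly_Mapping.lookup m i)"
  unfolding monomial_value_def by (rule prod.mono_neutral_left) (auto simp: in_keys_iff)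

lemma monomial_value_diff_single:
  assumes "Poly_Mapping.lookup m q \<noteq> 0"
  shows "v q * monomial_value v (m - Poly_Mapping.single q 1) = monomial_value v m"
proof -
  let ?K = "Poly_Mapping.keys m" and ?m = "m - Poly_Mapping.single q (1::nat)"
  have q: "q \<in> ?K" using assms by (simp add: in_keys_iff)
  have lookup: "Poly_Mapping.lookup ?m i = (if i = q then Poly_Mapping.lookup m i - 1 else Poly_Mapping.lookup m i)" for i
    by (simp add: lookup_minus lookup_single when_def)
  then have "Poly_Mapping.keys ?m \<subseteq> ?K"
    by (auto simp: in_keys_iff split: if_splits)
  then have "monomial_value v ?m = (\<Prod>i\<in>?K. v i ^ Poly_Mapping.lookup ?m i)"
    by (simp add: monomial_value_superset)
  also have "\<dots> = v q ^ (Poly_Mapping.lookup m q - 1) * (\<Prod>i\<in>?K - {q}. v i ^ Poly_Mapping.lookup m i)"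
    using q by (simp add: prod.remove lookup)
  finally show ?thesis
    using assms q
    by (simp add: monomial_value_def prod.remove mult.assoc[symmetric] power_Suc[symmetric]
        del: power_Suc)
qed

lemma eval_mpoly_superset:
  assumes "h 0 = 0" "finite S" "Poly_Mapping.keys p \<subseteq> S"
  shows "eval_mpoly h v p = (\<Sum>m\<in>S. h (Poly_Mapping.lookup p m) * monomial_value v m)"
  unfolding eval_mpoly_def monomial_value_def
  using assms by (intro sum.mono_neutral_left) (auto simp: in_keys_iff)

lemma eval_mpoly_single:
  "h 0 = 0 \<Longrightarrow> eval_mpoly h v (Poly_Mapping.single m c) = h c * monomial_value v m"
  by (simp add: eval_mpoly_superset[of h "{m}"])

lemma eval_mpoly_add:
  assumes "h 0 = 0" and add: "\<And>x y. h (x + y) = h x + h y"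
  shows "eval_mpoly h v (p + q) = eval_mpoly h v p + eval_mpoly h v q"
proof -
  let ?S = "Poly_Mapping.keys p \<union> Poly_Mapping.keys q"
  have "Poly_Mapping.keys (p + q) \<subseteq> ?S" by (rule keys_add)
  then show ?thesis
    using assms
    by (simp add: eval_mpoly_superset[of h ?S] lookup_add distrib_right sum.distrib)
qed

lemma eval_mpoly_sum_single:
  assumes "h 0 = 0" and add: "\<And>x y. h (x + y) = h x + h y"
  shows "eval_mpoly h v (\<Sum>m\<in>K. Poly_Mapping.single (f m) (c m)) =
    (\<Sum>m\<in>K. h (c m) * monomial_value v (f m))"
proof (induction K rule: infinite_finite_induct)
  case (insert m K)
  then show ?case using assms by (simp add: eval_mpoly_add eval_mpoly_single)
qed (simp_all add: eval_mpoly_def)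

lemma field_embedding_0: "field_embedding \<iota> \<Longrightarrow> \<iota> 0 = 0"
  unfolding field_embedding_def by (metis add_cancel_right_right)

lemma field_embedding_of_nat: "field_embedding \<iota> \<Longrightarrow> \<iota> (of_nat k) = of_nat k"
  by (induction k) (simp_all add: field_embedding_0, simp add: field_embedding_def)

text \<open>Multiplying \<open>\<partial>J/\<partial>a\<^sub>q\<close> by \<open>a\<^sub>q\<close> restores each monomial with its exponent of \<open>a\<^sub>q\<close> as a factor, and the
exponents in a monomial add up to \<open>n\<close>.\<close>

lemma euler_identity:
  fixes J :: "(nat, complex) mpoly"
  assumes emb: "field_embedding \<iota>" and vars: "vars J \<subseteq> {..d}" and hom: "homogeneous n J"
  shows "(\<Sum>q\<le>d. a q * eval_mpoly \<iota> a (pdiff q J)) = of_nat n * eval_mpoly \<iota> a J"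
proof -
  have add: "\<iota> (x + y) = \<iota> x + \<iota> y" and mult: "\<iota> (x * y) = \<iota> x * \<iota> y" for x y
    using emb by (simp_all add: field_embedding_def)
  let ?K = "Poly_Mapping.keys J"
  let ?t = "\<lambda>m. \<iota> (Poly_Mapping.lookup J m) * monomial_value a m"
  have "a q * eval_mpoly \<iota> a (pdiff q J) = (\<Sum>m\<in>?K. of_nat (Poly_Mapping.lookup m q) * ?t m)" for q
  proof -
    have "eval_mpoly \<iota> a (pdiff q J) = (\<Sum>m\<in>?K.
        \<iota> (of_nat (Poly_Mapping.lookup m q) * Poly_Mapping.lookup J m) *
          monomial_value a (m - Poly_Mapping.single q 1))"
      unfolding pdiff_def
      by (rule eval_mpoly_sum_single[OF field_embedding_0[OF emb] add])
    then have "a q * eval_mpoly \<iota> a (pdiff q J) = (\<Sum>m\<in>?K.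
        of_nat (Poly_Mapping.lookup m q) * (\<iota> (Poly_Mapping.lookup J m) *
          (a q * monomial_value a (m - Poly_Mapping.single q 1))))"
      by (simp only: sum_distrib_left mult field_embedding_of_nat[OF emb] ac_simps)
    also have "\<dots> = (\<Sum>m\<in>?K. of_nat (Poly_Mapping.lookup m q) * ?t m)"
    proof (intro sum.cong refl)
      fix m
      show "of_nat (Poly_Mapping.lookup m q) * (\<iota> (Poly_Mapping.lookup J m) *
          (a q * monomial_value a (m - Poly_Mapping.single q 1))) =
          of_nat (Poly_Mapping.lookup m q) * ?t m"
        by (cases "Poly_Mapping.lookup m q = 0") (simp_all add: monomial_value_diff_single)
    qed
    finally show ?thesis .
  qed
  then have "(\<Sum>q\<le>d. a q * eval_mpoly \<iota> a (pdiff q J)) =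
      (\<Sum>m\<in>?K. of_nat (\<Sum>q\<le>d. Poly_Mapping.lookup m q) * ?t m)"
    by (simp only: of_nat_sum sum_distrib_right sum.swap[of _ ?K])
  also have "\<dots> = (\<Sum>m\<in>?K. of_nat n * ?t m)"
  proof (intro sum.cong refl)
    fix m assume m: "m \<in> ?K"
    then have "Poly_Mapping.keys m \<subseteq> {..d}" using vars by (auto simp: vars_def)
    then have "(\<Sum>q\<le>d. Poly_Mapping.lookup m q) = (\<Sum>q\<in>Poly_Mapping.keys m. Poly_Mapping.lookup m q)"
      by (intro sum.mono_neutral_right) (auto simp: in_keys_iff)
    also have "\<dots> = n" using hom m by (simp add: homogeneous_def)
    finally show "of_nat (\<Sum>q\<le>d. Poly_Mapping.lookup m q) * ?t m = of_nat n * ?t m" by simp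
  qed
  finally show ?thesis
    by (simp add: eval_mpoly_def monomial_value_def sum_distrib_left)
qed

text \<open>The coefficients of the evectant as a form of order \<open>d\<close>, freed from the binomial factors. The
index is reversed because \<open>\<partial>J/\<partial>a\<^sub>q\<close> stands at \<open>x\<^sub>0\<^sup>q x\<^sub>1\<^sup>d\<^sup>-\<^sup>q\<close>.\<close>

definition evectant_coeff ::
  "(complex \<Rightarrow> 'k::field_char_0) \<Rightarrow> nat \<Rightarrow> nat \<Rightarrow> (nat, complex) mpoly \<Rightarrow> (nat \<Rightarrow> 'k) \<Rightarrow> nat \<Rightarrow> 'k"
  where
  "evectant_coeff \<iota> d n J a p =
     (- 1) ^ d / of_nat n * ((- 1) ^ (d - p) * eval_mpoly \<iota> a (pdiff (d - p) J)) / of_nat (d choose p)"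

lemma evectant_form: "evectant \<iota> d n J a = form d (evectant_coeff \<iota> d n J a)"
proof -
  have "evectant \<iota> d n J a = (\<Sum>q\<le>d. Const ((- 1) ^ d / of_nat n *
      ((- 1) ^ q * eval_mpoly \<iota> a (pdiff q J))) * Var 0 ^ q * Var 1 ^ (d - q))"
    by (simp only: evectant_def sum_distrib_left Const_mult mult.assoc)
  also have "\<dots> = form d (evectant_coeff \<iota> d n J a)"
    unfolding form_def evectant_coeff_def
    by (rule sum.reindex_bij_witness[where i = "\<lambda>p. d - p" and j = "\<lambda>q. d - q"]) auto
  finally show ?thesis .
qed

text \<open>The signs in the evectant are those for which the full transvectant pairs \<open>\<partial>J/\<partial>a\<^sub>p\<close> with \<open>a\<^sub>p\<close> with
sign \<open>+1\<close>, so that Euler's identity applies.\<close>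

lemma transvectant_evectant_form:
  assumes "field_embedding \<iota>" and "vars J \<subseteq> {..d}" and "homogeneous n J" and "n \<ge> 1"
  shows "transvectant d d d (evectant \<iota> d n J a) (form d a) = Const (eval_mpoly \<iota> a J)"
proof -
  have "(- 1) ^ (d - p) * of_nat (d choose p) * evectant_coeff \<iota> d n J a (d - p) * a p =
      a p * eval_mpoly \<iota> a (pdiff p J) / of_nat n" if "p \<le> d" for p
  proof -
    have "(- 1 :: 'a) ^ (d - p) * ((- 1) ^ d * (- 1) ^ p) = (- 1) ^ (d - p + (d + p))"
      by (simp only: power_add)
    also have "d - p + (d + p) = 2 * d" using that by simp
    finally have sign: "(- 1 :: 'a) ^ (d - p) * ((- 1) ^ d * (- 1) ^ p) = 1" by simp
    have "(- 1) ^ (d - p) * of_nat (d choose p) * evectant_coeff \<iota> d n J a (d - p) * a p =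
        ((- 1) ^ (d - p) * ((- 1) ^ d * (- 1) ^ p)) * (a p * eval_mpoly \<iota> a (pdiff p J) / of_nat n)"
      using that by (simp add: evectant_coeff_def binomial_symmetric[symmetric])
    then show ?thesis by (simp only: sign mult_1)
  qed
  then have "(\<Sum>p\<le>d. (- 1) ^ (d - p) * of_nat (d choose p) * evectant_coeff \<iota> d n J a (d - p) * a p) =
      (\<Sum>p\<le>d. a p * eval_mpoly \<iota> a (pdiff p J)) / of_nat n"
    by (simp add: sum_divide_distrib)
  also have "\<dots> = eval_mpoly \<iota> a J"
    using assms(4) by (simp add: euler_identity[OF assms(1-3)])
  finally show ?thesis
    by (simp only: evectant_form transvectant_full_form)
qed

section \<open>Algebraic independence and the value of the invariant\<close>

text \<open>Algebraic independence speaks about polynomials in the disjoint union of the coefficients of \<open>A\<close> and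
\<open>B\<close>. An invariant of \<open>A\<close> is carried there by renaming its variables along \<open>Inl\<close>.\<close>

definition Inl_monomial :: "('v \<Rightarrow>\<^sub>0 nat) \<Rightarrow> ('v + 'w \<Rightarrow>\<^sub>0 nat)" where
  "Inl_monomial m = (\<Sum>i\<in>Poly_Mapping.keys m. Poly_Mapping.single (Inl i) (Poly_Mapping.lookup m i))"

lemma lookup_Inl_monomial:
  "Poly_Mapping.lookup (Inl_monomial m) k =
     (case k of Inl i \<Rightarrow> Poly_Mapping.lookup m i | Inr _ \<Rightarrow> 0)"
  by (cases k) (simp_all add: Inl_monomial_def lookup_sum lookup_single when_def in_keys_iff)

lemma inj_Inl_monomial: "inj (Inl_monomial :: ('v \<Rightarrow>\<^sub>0 nat) \<Rightarrow> ('v + 'w \<Rightarrow>\<^sub>0 nat))"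
proof (rule injI, rule poly_mapping_eqI)
  fix m m' :: "'v \<Rightarrow>\<^sub>0 nat" and i
  assume eq: "Inl_monomial m = (Inl_monomial m' :: 'v + 'w \<Rightarrow>\<^sub>0 nat)"
  show "Poly_Mapping.lookup m i = Poly_Mapping.lookup m' i"
    using arg_cong[OF eq, of "\<lambda>x. Poly_Mapping.lookup x (Inl i)"]
    by (simp add: lookup_Inl_monomial)
qed

lemma keys_Inl_monomial: "Poly_Mapping.keys (Inl_monomial m) = Inl ` Poly_Mapping.keys m"
proof (rule set_eqI)
  fix k :: "'a + 'b"
  show "k \<in> Poly_Mapping.keys (Inl_monomial m) \<longleftrightarrow> k \<in> Inl ` Poly_Mapping.keys m"
    by (cases k) (auto simp: in_keys_iff lookup_Inl_monomial)
qed

lemma algebraically_independent_eval_nonzero: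
  fixes a b :: "nat \<Rightarrow> 'k::field"
  assumes emb: "field_embedding \<iota>"
    and indep: "algebraically_independent \<iota> (I <+> I') (case_sum a b)"
    and vars: "vars J \<subseteq> I" and "J \<noteq> 0"
  shows "eval_mpoly \<iota> a J \<noteq> 0"
proof
  assume zero: "eval_mpoly \<iota> a J = 0"
  let ?K = "Poly_Mapping.keys J"
  define P :: "(nat + nat, complex) mpoly" where
    "P = (\<Sum>m\<in>?K. Poly_Mapping.single (Inl_monomial m) (Poly_Mapping.lookup J m))"
  have add: "\<iota> (x + y) = \<iota> x + \<iota> y" for x y
    using emb by (simp add: field_embedding_def)
  have "monomial_value (case_sum a b) (Inl_monomial m) = monomial_value a m" for m
    by (simp add: monomial_value_def keys_Inl_monomial prod.reindex lookup_Inl_monomial)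
  then have "eval_mpoly \<iota> (case_sum a b) P = eval_mpoly \<iota> a J"
    unfolding P_def eval_mpoly_sum_single[OF field_embedding_0[OF emb] add]
    by (simp add: eval_mpoly_def monomial_value_def)
  moreover have "vars P \<subseteq> I <+> I'"
  proof -
    have "Poly_Mapping.keys P \<subseteq> (\<Union>m\<in>?K. Poly_Mapping.keys
        (Poly_Mapping.single (Inl_monomial m) (Poly_Mapping.lookup J m)))"
      unfolding P_def by (rule keys_sum)
    then have "Poly_Mapping.keys P \<subseteq> Inl_monomial ` ?K"
      by (auto split: if_splits)
    then have "vars P \<subseteq> (\<Union>m\<in>Inl_monomial ` ?K. Poly_Mapping.keys m)"
      unfolding vars_def by blast
    also have "\<dots> = Inl ` vars J"
      by (simp add: vars_def keys_Inl_monomial image_UN)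
    finally have "vars P \<subseteq> Inl ` vars J" .
    with vars show ?thesis by auto
  qed
  ultimately have "P = 0"
    using indep zero by (simp add: algebraically_independent_def)
  moreover have "Poly_Mapping.lookup P (Inl_monomial m) = Poly_Mapping.lookup J m" for m
    by (simp add: P_def lookup_sum lookup_single when_def inj_eq[OF inj_Inl_monomial] in_keys_iff)
  ultimately have "J = 0"
    by (intro poly_mapping_eqI) (metis lookup_zero)
  with \<open>J \<noteq> 0\<close> show False ..
qed

theorem theorem4p3:
  fixes \<iota> :: "complex \<Rightarrow> 'k::field_char_0"
    and a b :: "nat \<Rightarrow> 'k"
    and A B :: "(nat, 'k) mpoly"
    and T :: "nat \<Rightarrow> (nat, 'k) mpoly"
    and J :: "(nat, complex) mpoly"
    and d n :: nat
  assumes "field_embedding \<iota>"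
    and "algebraically_independent \<iota> ({..d} <+> {..d}) (case_sum a b)"
    and "A = form d a" and "B = form d b"
    and "n \<ge> 1" and "invariant d n J" and "J \<noteq> 0"
    and "\<And>r. T r = transvectant d d (2 * r + 1) A B"
  shows "beta \<iota> d n J a T =
           B - Const (1 / eval_mpoly \<iota> a J) * transvectant d d d (evectant \<iota> d n J a) B * A"
proof -
  let ?E = "evectant \<iota> d n J a" and ?j = "eval_mpoly \<iota> a J"
  have J: "vars J \<subseteq> {..d}" "homogeneous n J"
    using assms(6) by (simp_all add: invariant_def)
  have nonzero: "?j \<noteq> 0"
    by (rule algebraically_independent_eval_nonzero[OF assms(1,2) J(1) assms(7)])
  have indices: "{r. int r \<le> (int d - 1) div 2} = {r. 2 * r + 1 \<le> d}"
    by auto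
  have "trilinear_defect d ?E A B = 0"
    unfolding evectant_form assms(3,4) by (rule trilinear_defect_zero)
  moreover have "transvectant d d d ?E A = Const ?j"
    unfolding assms(3) by (rule transvectant_evectant_form[OF assms(1) J assms(5)])
  ultimately have sum: "(\<Sum>r | 2 * r + 1 \<le> d. Const (beta_coeff d r) *
      transvectant d (2 * d - 2 * (2 * r + 1)) (d - 2 * r - 1) ?E (T r)) =
      transvectant d d d ?E B * A - Const ?j * B"
    by (simp add: trilinear_defect_def assms(8))
  have "beta \<iota> d n J a T = - Const (1 / ?j) * (transvectant d d d ?E B * A - Const ?j * B)"
    unfolding beta_def indices beta_coeff_def[symmetric] sum ..
  also have "\<dots> = Const (1 / ?j) * (Const ?j * B) - Const (1 / ?j) * transvectant d d d ?E B * A"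
    by (simp add: algebra_simps)
  also have "Const (1 / ?j) * (Const ?j * B) = B"
    using nonzero by (simp add: Const_mult_assoc)
  finally show ?thesis .
qed

end
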